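(* Let $M(\phi,\xi,\eta,g_M)$ be a cosymplectic manifold, let $(N,g_N)$ be a Riemannian manifold, and let $F:M(\phi,\xi,\eta,g_M)\to(N,g_N)$ be an anti-invariant Riemannian submersion such that $(\ker F_* )^\perp=\phi(\ker F_* )\oplus\{\xi\}$. Then $M$ is a locally product manifold if and only if $\mathcal{A}_X\phi Y=0$ and $\mathcal{T}_V\phi W=0$ for all $W,V\in\Gamma(\ker F_* )$ and $X,Y\in\Gamma((\ker F_* )^\perp)$.
   Context: An almost contact metric structure $(\phi,\xi,\eta,g)$ on a $(2m+1)$-dimensional manifold $M$ consists of a $(1,1)$-tensor field $\phi$, a vector field $\xi$, a 1-form $\eta$ and a Riemannian metric $g$ with $\phi^2=-I+\eta\otimes\xi$, $\phi\xi=0$, $\eta\circ\phi=0$, $\eta(\xi)=1$, $g(\phi X,\phi Y)=g(X,Y)-\eta(X)\eta(Y)$, $\eta(X)=g(X,\xi)$. It is cosymplectic if it is normal ($[\phi,\phi]+2d\eta\otimes\xi=0$) and both $\eta$ and $\Phi(X,Y)=g(X,\phi Y)$ are closed; the structure equation of a cosymplectic manifold is $(\nabla_X\phi)Y=0$, where $\nabla$ is the Levi-Civita connection of $g$, and then $\nabla_X\xi=0$. A Riemannian submersion $F:(M,g_M)\to(N,g_N)$ is a smooth surjective map of maximal rank whose differential $F_*$ preserves the lengths of horizontal vectors. Vectors in $\ker F_*$ are vertical and vectors in $(\ker F_* )^\perp$ are horizontal; $\mathcal{V}$ and $\mathcal{H}$ are the orthogonal projections on $\ker F_*$ and $(\ker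 F_* )^\perp$. $F$ is anti-invariant if $\phi(\ker F_* )\subseteq(\ker F_* )^\perp$. Here $\{\xi\}$ denotes the line distribution spanned by $\xi$. O'Neill's tensors: for vector fields $E,G$ on $M$, $\mathcal{T}_EG=\mathcal{H}\nabla_{\mathcal{V}E}\mathcal{V}G+\mathcal{V}\nabla_{\mathcal{V}E}\mathcal{H}G$ and $\mathcal{A}_EG=\mathcal{V}\nabla_{\mathcal{H}E}\mathcal{H}G+\mathcal{H}\nabla_{\mathcal{H}E}\mathcal{V}G$. "$M$ is a locally product manifold" means that $M$ is locally a Riemannian product whose two canonical foliations are given by $\ker F_*$ and $(\ker F_* )^\perp$; equivalently, both distributions define totally geodesic foliations on $M$. *)

theory Defs
  imports "HOL-Analysis.Analysis" "HOL-Library.Function_Algebras"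
begin

instantiation "fun" :: (type, real_vector) real_vector
begin

definition scaleR_fun :: "real \<Rightarrow> ('a \<Rightarrow> 'b) \<Rightarrow> 'a \<Rightarrow> 'b"
  where "scaleR_fun c f = (\<lambda>x. c *\<^sub>R f x)"

instance
  by standard (simp_all add: scaleR_fun_def plus_fun_def fun_eq_iff scaleR_add_right scaleR_add_left)

end


section \<open>Smooth manifolds\<close>

primrec Ck_on :: "nat \<Rightarrow> 'a::euclidean_space set \<Rightarrow> ('a \<Rightarrow> 'b::real_normed_vector) \<Rightarrow> bool"
  where
    "Ck_on 0 S f \<longleftrightarrow> continuous_on S f"
  | "Ck_on (Suc k) S f \<longleftrightarrow>
       (\<forall>x\<in>S. f differentiable (at x)) \<and>
       (\<forall>u. Ck_on k S (\<lambda>x. frechet_derivative f (at x) u))"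

text \<open>Only used for open \<open>S\<close>.\<close>
definition smooth_on :: "'a::euclidean_space set \<Rightarrow> ('a \<Rightarrow> 'b::real_normed_vector) \<Rightarrow> bool"
  where "smooth_on S f \<longleftrightarrow> (\<forall>k. Ck_on k S f)"

text \<open>
  The underlying set of a manifold is a whole type. A chart is a pair of an open domain \<open>U\<close> and a
  coordinate map \<open>\<psi>\<close>, of which only the values on \<open>U\<close> matter.
\<close>
type_synonym ('m, 'e) chart = "'m set \<times> ('m \<Rightarrow> 'e)"
type_synonym ('m, 'e) atlas = "('m, 'e) chart set"

definition smooth_manifold ::
    "('m::{t2_space, second_countable_topology}, 'e::euclidean_space) atlas \<Rightarrow> bool"
  where "smooth_manifold A \<longleftrightarrow>
    (\<Union>(U, \<psi>)\<in>A. U) = UNIV \<and>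
    (\<forall>(U, \<psi>)\<in>A. open U \<and> open (\<psi> ` U) \<and> homeomorphism U (\<psi> ` U) \<psi> (inv_into U \<psi>)) \<and>
    (\<forall>(U, \<psi>)\<in>A. \<forall>(V, \<theta>)\<in>A. smooth_on (\<psi> ` (U \<inter> V)) (\<theta> \<circ> inv_into U \<psi>))"

definition smooth_functions :: "('m, 'e::euclidean_space) atlas \<Rightarrow> ('m \<Rightarrow> real) set"
  where "smooth_functions A = {f. \<forall>(U, \<psi>)\<in>A. smooth_on (\<psi> ` U) (f \<circ> inv_into U \<psi>)}"

definition smooth_map ::
    "('m::topological_space, 'e::euclidean_space) atlas \<Rightarrow>
     ('n::topological_space, 'd::euclidean_space) atlas \<Rightarrow> ('m \<Rightarrow> 'n) \<Rightarrow> bool"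
  where "smooth_map A B F \<longleftrightarrow> continuous_on UNIV F \<and>
    (\<forall>(U, \<psi>)\<in>A. \<forall>(V, \<theta>)\<in>B. smooth_on (\<psi> ` (U \<inter> F -` V)) (\<theta> \<circ> F \<circ> inv_into U \<psi>))"


section \<open>Tangent vectors and vector fields\<close>

text \<open>
  Tangent vectors are derivations of the algebra of globally defined smooth functions, namely the
  directional derivatives in charts. They are set to 0 on functions that are not smooth, so that
  equality of tangent vectors is equality of HOL functions.
\<close>
type_synonym 'm tangent_vector = "('m \<Rightarrow> real) \<Rightarrow> real"
type_synonym 'm vector_field = "'m \<Rightarrow> 'm tangent_vector"

definition chart_derivative ::
    "('m, 'e::euclidean_space) atlas \<Rightarrow> ('m, 'e) chart \<Rightarrow> 'm \<Rightarrow> 'e \<Rightarrow> 'm tangent_vector"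
  where "chart_derivative A c p u = (\<lambda>f.
    if f \<in> smooth_functions A
    then frechet_derivative (f \<circ> inv_into (fst c) (snd c)) (at (snd c p)) u
    else 0)"

definition tangent_space ::
    "('m, 'e::euclidean_space) atlas \<Rightarrow> 'm \<Rightarrow> 'm tangent_vector set"
  where "tangent_space A p = {chart_derivative A c p u | c u. c \<in> A \<and> p \<in> fst c}"

definition vector_fields :: "('m, 'e::euclidean_space) atlas \<Rightarrow> 'm vector_field set"
  where "vector_fields A = {X. (\<forall>p. X p \<in> tangent_space A p) \<and>
    (\<forall>f\<in>smooth_functions A. (\<lambda>p. X p f) \<in> smooth_functions A)}"

definition fmult :: "('m \<Rightarrow> real) \<Rightarrow> 'm vector_field \<Rightarrow> 'm vector_field"
  where "fmult h X = (\<lambda>p. h p *\<^sub>R X p)"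

definition vderiv :: "'m vector_field \<Rightarrow> ('m \<Rightarrow> real) \<Rightarrow> 'm \<Rightarrow> real"
  where "vderiv X f = (\<lambda>p. X p f)"

definition lie_bracket :: "'m vector_field \<Rightarrow> 'm vector_field \<Rightarrow> 'm vector_field"
  where "lie_bracket X Y = (\<lambda>p f. X p (vderiv Y f) - Y p (vderiv X f))"

definition sections ::
    "('m, 'e::euclidean_space) atlas \<Rightarrow> ('m \<Rightarrow> 'm tangent_vector set) \<Rightarrow> 'm vector_field set"
  where "sections A D = {X \<in> vector_fields A. \<forall>p. X p \<in> D p}"

text \<open>The differential of \<open>F\<close>; as an operator on derivations it does not mention the base point.\<close>
definition differential ::
    "('n, 'd::euclidean_space) atlas \<Rightarrow> ('m \<Rightarrow> 'n) \<Rightarrow> 'm tangent_vector \<Rightarrow> 'n tangent_vector"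
  where "differential B F v = (\<lambda>h. if h \<in> smooth_functions B then v (h \<circ> F) else 0)"


section \<open>Tensor fields\<close>

type_synonym 'm one_form = "'m \<Rightarrow> 'm tangent_vector \<Rightarrow> real"
type_synonym 'm bilinear_form = "'m \<Rightarrow> 'm tangent_vector \<Rightarrow> 'm tangent_vector \<Rightarrow> real"
type_synonym 'm endomorphism_field = "'m \<Rightarrow> 'm tangent_vector \<Rightarrow> 'm tangent_vector"

text \<open>Smoothness of a tensor field is tested on smooth vector fields.\<close>
definition smooth_one_form ::
    "('m, 'e::euclidean_space) atlas \<Rightarrow> 'm one_form \<Rightarrow> bool"
  where "smooth_one_form A \<alpha> \<longleftrightarrow>
    (\<forall>p. \<forall>v\<in>tangent_space A p. \<forall>w\<in>tangent_space A p. \<alpha> p (v + w) = \<alpha> p v + \<alpha> p w) \<and>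
    (\<forall>p. \<forall>v\<in>tangent_space A p. \<forall>c. \<alpha> p (c *\<^sub>R v) = c * \<alpha> p v) \<and>
    (\<forall>X\<in>vector_fields A. (\<lambda>p. \<alpha> p (X p)) \<in> smooth_functions A)"

definition smooth_endomorphism_field ::
    "('m, 'e::euclidean_space) atlas \<Rightarrow> 'm endomorphism_field \<Rightarrow> bool"
  where "smooth_endomorphism_field A \<phi> \<longleftrightarrow>
    (\<forall>p. \<forall>v\<in>tangent_space A p. \<phi> p v \<in> tangent_space A p) \<and>
    (\<forall>p. \<forall>v\<in>tangent_space A p. \<forall>w\<in>tangent_space A p. \<phi> p (v + w) = \<phi> p v + \<phi> p w) \<and>
    (\<forall>p. \<forall>v\<in>tangent_space A p. \<forall>c. \<phi> p (c *\<^sub>R v) = c *\<^sub>R \<phi> p v) \<and>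
    (\<forall>X\<in>vector_fields A. (\<lambda>p. \<phi> p (X p)) \<in> vector_fields A)"

definition riemannian_metric ::
    "('m, 'e::euclidean_space) atlas \<Rightarrow> 'm bilinear_form \<Rightarrow> bool"
  where "riemannian_metric A g \<longleftrightarrow>
    (\<forall>p. \<forall>v\<in>tangent_space A p. \<forall>w\<in>tangent_space A p. g p v w = g p w v) \<and>
    (\<forall>p. \<forall>u\<in>tangent_space A p. \<forall>v\<in>tangent_space A p. \<forall>w\<in>tangent_space A p.
      g p (u + v) w = g p u w + g p v w) \<and>
    (\<forall>p. \<forall>v\<in>tangent_space A p. \<forall>w\<in>tangent_space A p. \<forall>c. g p (c *\<^sub>R v) w = c * g p v w) \<and>
    (\<forall>p. \<forall>v\<in>tangent_space A p. v \<noteq> 0 \<longrightarrow> g p v v > 0) \<and>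
    (\<forall>X\<in>vector_fields A. \<forall>Y\<in>vector_fields A. (\<lambda>p. g p (X p) (Y p)) \<in> smooth_functions A)"

definition tapply :: "'m endomorphism_field \<Rightarrow> 'm vector_field \<Rightarrow> 'm vector_field"
  where "tapply \<phi> X = (\<lambda>p. \<phi> p (X p))"

definition fform :: "'m one_form \<Rightarrow> 'm vector_field \<Rightarrow> 'm \<Rightarrow> real"
  where "fform \<alpha> X = (\<lambda>p. \<alpha> p (X p))"

definition fform2 :: "'m bilinear_form \<Rightarrow> 'm vector_field \<Rightarrow> 'm vector_field \<Rightarrow> 'm \<Rightarrow> real"
  where "fform2 \<omega> X Y = (\<lambda>p. \<omega> p (X p) (Y p))"

text \<open>
  Exterior derivatives, normalised with the factors 1/2 and 1/3 as is customary in almost contact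
  geometry; the factor 2 in the normality condition refers to this convention.
\<close>
definition ext_deriv1 ::
    "'m one_form \<Rightarrow> 'm vector_field \<Rightarrow> 'm vector_field \<Rightarrow> 'm \<Rightarrow> real"
  where "ext_deriv1 \<alpha> X Y = (\<lambda>p. (1/2) *
    (vderiv X (fform \<alpha> Y) p - vderiv Y (fform \<alpha> X) p - fform \<alpha> (lie_bracket X Y) p))"

definition ext_deriv2 ::
    "'m bilinear_form \<Rightarrow> 'm vector_field \<Rightarrow> 'm vector_field \<Rightarrow> 'm vector_field \<Rightarrow> 'm \<Rightarrow> real"
  where "ext_deriv2 \<omega> X Y Z = (\<lambda>p. (1/3) *
    (vderiv X (fform2 \<omega> Y Z) p + vderiv Y (fform2 \<omega> Z X) p + vderiv Z (fform2 \<omega> X Y) p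
     - fform2 \<omega> (lie_bracket X Y) Z p - fform2 \<omega> (lie_bracket Y Z) X p
     - fform2 \<omega> (lie_bracket Z X) Y p))"

text \<open>The Levi-Civita connection, characterised by the properties that determine it uniquely.\<close>
definition levi_civita ::
    "('m, 'e::euclidean_space) atlas \<Rightarrow> 'm bilinear_form \<Rightarrow>
     ('m vector_field \<Rightarrow> 'm vector_field \<Rightarrow> 'm vector_field) \<Rightarrow> bool"
  where "levi_civita A g nab \<longleftrightarrow>
    (\<forall>X\<in>vector_fields A. \<forall>Y\<in>vector_fields A. nab X Y \<in> vector_fields A) \<and>
    (\<forall>X\<in>vector_fields A. \<forall>Y\<in>vector_fields A. \<forall>Z\<in>vector_fields A.
      nab (X + Y) Z = nab X Z + nab Y Z \<and> nab X (Y + Z) = nab X Y + nab X Z) \<and>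
    (\<forall>h\<in>smooth_functions A. \<forall>X\<in>vector_fields A. \<forall>Y\<in>vector_fields A.
      nab (fmult h X) Y = fmult h (nab X Y) \<and>
      nab X (fmult h Y) = fmult (vderiv X h) Y + fmult h (nab X Y)) \<and>
    (\<forall>X\<in>vector_fields A. \<forall>Y\<in>vector_fields A. nab X Y - nab Y X = lie_bracket X Y) \<and>
    (\<forall>X\<in>vector_fields A. \<forall>Y\<in>vector_fields A. \<forall>Z\<in>vector_fields A.
      vderiv X (fform2 g Y Z) = fform2 g (nab X Y) Z + fform2 g Y (nab X Z))"


section \<open>Cosymplectic manifolds\<close>

definition almost_contact_metric ::
    "('m, 'e::euclidean_space) atlas \<Rightarrow> 'm endomorphism_field \<Rightarrow> 'm vector_field \<Rightarrow>
     'm one_form \<Rightarrow> 'm bilinear_form \<Rightarrow> bool"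
  where "almost_contact_metric A \<phi> \<xi> \<eta> g \<longleftrightarrow>
    odd DIM('e) \<and>
    smooth_endomorphism_field A \<phi> \<and> \<xi> \<in> vector_fields A \<and> smooth_one_form A \<eta> \<and>
    riemannian_metric A g \<and>
    (\<forall>p. \<forall>v\<in>tangent_space A p. \<phi> p (\<phi> p v) = - v + \<eta> p v *\<^sub>R \<xi> p) \<and>
    (\<forall>p. \<phi> p (\<xi> p) = 0) \<and>
    (\<forall>p. \<forall>v\<in>tangent_space A p. \<eta> p (\<phi> p v) = 0) \<and>
    (\<forall>p. \<eta> p (\<xi> p) = 1) \<and>
    (\<forall>p. \<forall>v\<in>tangent_space A p. \<forall>w\<in>tangent_space A p.
      g p (\<phi> p v) (\<phi> p w) = g p v w - \<eta> p v * \<eta> p w) \<and>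
    (\<forall>p. \<forall>v\<in>tangent_space A p. \<eta> p v = g p v (\<xi> p))"

definition nijenhuis ::
    "'m endomorphism_field \<Rightarrow> 'm vector_field \<Rightarrow> 'm vector_field \<Rightarrow> 'm vector_field"
  where "nijenhuis \<phi> X Y =
    tapply \<phi> (tapply \<phi> (lie_bracket X Y)) + lie_bracket (tapply \<phi> X) (tapply \<phi> Y)
    - tapply \<phi> (lie_bracket (tapply \<phi> X) Y) - tapply \<phi> (lie_bracket X (tapply \<phi> Y))"

definition fundamental_form :: "'m endomorphism_field \<Rightarrow> 'm bilinear_form \<Rightarrow> 'm bilinear_form"
  where "fundamental_form \<phi> g = (\<lambda>p v w. g p v (\<phi> p w))"

definition cosymplectic ::
    "('m, 'e::euclidean_space) atlas \<Rightarrow> 'm endomorphism_field \<Rightarrow> 'm vector_field \<Rightarrow>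
     'm one_form \<Rightarrow> 'm bilinear_form \<Rightarrow> bool"
  where "cosymplectic A \<phi> \<xi> \<eta> g \<longleftrightarrow>
    almost_contact_metric A \<phi> \<xi> \<eta> g \<and>
    (\<forall>X\<in>vector_fields A. \<forall>Y\<in>vector_fields A.
      nijenhuis \<phi> X Y + fmult (\<lambda>p. 2 * ext_deriv1 \<eta> X Y p) \<xi> = 0) \<and>
    (\<forall>X\<in>vector_fields A. \<forall>Y\<in>vector_fields A. ext_deriv1 \<eta> X Y = 0) \<and>
    (\<forall>X\<in>vector_fields A. \<forall>Y\<in>vector_fields A. \<forall>Z\<in>vector_fields A.
      ext_deriv2 (fundamental_form \<phi> g) X Y Z = 0)"


section \<open>Riemannian submersions\<close>

definition vertical ::
    "('m, 'e::euclidean_space) atlas \<Rightarrow> ('n, 'd::euclidean_space) atlas \<Rightarrow> ('m \<Rightarrow> 'n) \<Rightarrow>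
     'm \<Rightarrow> 'm tangent_vector set"
  where "vertical A B F p = {v \<in> tangent_space A p. differential B F v = 0}"

definition horizontal ::
    "('m, 'e::euclidean_space) atlas \<Rightarrow> 'm bilinear_form \<Rightarrow>
     ('n, 'd::euclidean_space) atlas \<Rightarrow> ('m \<Rightarrow> 'n) \<Rightarrow> 'm \<Rightarrow> 'm tangent_vector set"
  where "horizontal A g B F p = {v \<in> tangent_space A p. \<forall>w\<in>vertical A B F p. g p v w = 0}"

definition riemannian_submersion ::
    "('m::topological_space, 'e::euclidean_space) atlas \<Rightarrow> 'm bilinear_form \<Rightarrow>
     ('n::topological_space, 'd::euclidean_space) atlas \<Rightarrow> 'n bilinear_form \<Rightarrow> ('m \<Rightarrow> 'n) \<Rightarrow> bool"
  where "riemannian_submersion A g B g' F \<longleftrightarrow>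
    smooth_map A B F \<and> surj F \<and>
    (\<forall>p. differential B F ` tangent_space A p = tangent_space B (F p)) \<and>
    (\<forall>p. \<forall>v\<in>horizontal A g B F p.
      sqrt (g' (F p) (differential B F v) (differential B F v)) = sqrt (g p v v))"

definition anti_invariant ::
    "('m, 'e::euclidean_space) atlas \<Rightarrow> 'm endomorphism_field \<Rightarrow> 'm bilinear_form \<Rightarrow>
     ('n, 'd::euclidean_space) atlas \<Rightarrow> ('m \<Rightarrow> 'n) \<Rightarrow> bool"
  where "anti_invariant A \<phi> g B F \<longleftrightarrow>
    (\<forall>p. \<phi> p ` vertical A B F p \<subseteq> horizontal A g B F p)"

definition is_direct_sum :: "'v::real_vector set \<Rightarrow> 'v set \<Rightarrow> 'v set \<Rightarrow> bool"
  where "is_direct_sum S S1 S2 \<longleftrightarrow> S = {v + w | v w. v \<in> S1 \<and> w \<in> S2} \<and> S1 \<inter> S2 = {0}"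

definition orth_proj ::
    "('v::real_vector \<Rightarrow> 'v \<Rightarrow> real) \<Rightarrow> 'v set \<Rightarrow> 'v \<Rightarrow> 'v"
  where "orth_proj ip S v = (THE w. w \<in> S \<and> (\<forall>u\<in>S. ip (v - w) u = 0))"

definition vproj ::
    "('m, 'e::euclidean_space) atlas \<Rightarrow> 'm bilinear_form \<Rightarrow>
     ('n, 'd::euclidean_space) atlas \<Rightarrow> ('m \<Rightarrow> 'n) \<Rightarrow> 'm vector_field \<Rightarrow> 'm vector_field"
  where "vproj A g B F E = (\<lambda>p. orth_proj (g p) (vertical A B F p) (E p))"

definition hproj ::
    "('m, 'e::euclidean_space) atlas \<Rightarrow> 'm bilinear_form \<Rightarrow>
     ('n, 'd::euclidean_space) atlas \<Rightarrow> ('m \<Rightarrow> 'n) \<Rightarrow> 'm vector_field \<Rightarrow> 'm vector_field"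
  where "hproj A g B F E = (\<lambda>p. orth_proj (g p) (horizontal A g B F p) (E p))"

definition oneill_T ::
    "('m, 'e::euclidean_space) atlas \<Rightarrow> 'm bilinear_form \<Rightarrow>
     ('m vector_field \<Rightarrow> 'm vector_field \<Rightarrow> 'm vector_field) \<Rightarrow>
     ('n, 'd::euclidean_space) atlas \<Rightarrow> ('m \<Rightarrow> 'n) \<Rightarrow>
     'm vector_field \<Rightarrow> 'm vector_field \<Rightarrow> 'm vector_field"
  where "oneill_T A g nab B F E G =
    (let \<V> = vproj A g B F; \<H> = hproj A g B F
     in \<H> (nab (\<V> E) (\<V> G)) + \<V> (nab (\<V> E) (\<H> G)))"

definition oneill_A ::
    "('m, 'e::euclidean_space) atlas \<Rightarrow> 'm bilinear_form \<Rightarrow>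
     ('m vector_field \<Rightarrow> 'm vector_field \<Rightarrow> 'm vector_field) \<Rightarrow>
     ('n, 'd::euclidean_space) atlas \<Rightarrow> ('m \<Rightarrow> 'n) \<Rightarrow>
     'm vector_field \<Rightarrow> 'm vector_field \<Rightarrow> 'm vector_field"
  where "oneill_A A g nab B F E G =
    (let \<V> = vproj A g B F; \<H> = hproj A g B F
     in \<V> (nab (\<H> E) (\<H> G)) + \<H> (nab (\<H> E) (\<V> G)))"


section \<open>Locally product manifolds\<close>

text \<open>
  A (smooth, constant rank) distribution defines a totally geodesic foliation if it is integrable,
  i.e. involutive, and the second fundamental form of its leaves vanishes, i.e. it is closed under
  covariant differentiation along itself.
\<close>
definition totally_geodesic_foliation ::
    "('m, 'e::euclidean_space) atlas \<Rightarrow>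
     ('m vector_field \<Rightarrow> 'm vector_field \<Rightarrow> 'm vector_field) \<Rightarrow>
     ('m \<Rightarrow> 'm tangent_vector set) \<Rightarrow> bool"
  where "totally_geodesic_foliation A nab D \<longleftrightarrow>
    (\<forall>X\<in>sections A D. \<forall>Y\<in>sections A D. lie_bracket X Y \<in> sections A D) \<and>
    (\<forall>X\<in>sections A D. \<forall>Y\<in>sections A D. nab X Y \<in> sections A D)"

definition locally_product_manifold ::
    "('m, 'e::euclidean_space) atlas \<Rightarrow> 'm bilinear_form \<Rightarrow>
     ('m vector_field \<Rightarrow> 'm vector_field \<Rightarrow> 'm vector_field) \<Rightarrow>
     ('n, 'd::euclidean_space) atlas \<Rightarrow> ('m \<Rightarrow> 'n) \<Rightarrow> bool"
  where "locally_product_manifold A g nab B F \<longleftrightarrow>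
    totally_geodesic_foliation A nab (vertical A B F) \<and>
    totally_geodesic_foliation A nab (horizontal A g B F)"

end

theory Submission
  imports Defs
begin

text \<open>
  Put \<open>h X = \<nabla>\<^sub>X \<xi>\<close> and \<open>S(X,Y,Z) = g((\<nabla>\<^sub>X \<phi>)Y, Z)\<close>. Closedness of the fundamental form says that
  the cyclic sum of \<open>S\<close> vanishes, and \<open>S\<close> is skew in its last two arguments. Closedness of \<open>\<eta>\<close> makes
  \<open>h\<close> self-adjoint. Normality against \<open>\<xi>\<close> determines \<open>\<nabla>\<^sub>\<xi> \<phi>\<close> in terms of \<open>h\<close> in one way, the cyclic
  identity in another, and the comparison forces \<open>h = 0\<close>. Then \<open>\<nabla>\<phi>\<close> anticommutes with \<open>\<phi>\<close> and the
  classical argument for Kaehler manifolds yields \<open>\<nabla>\<phi> = 0\<close>.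

  Since the horizontal space is \<open>\<phi>\<close> of the vertical space plus the line of \<open>\<xi>\<close>, \<open>\<phi>\<close> also maps
  horizontal to vertical vectors. Hence \<open>A\<^sub>X \<phi>Y\<close> is the horizontal part of \<open>\<phi> \<nabla>\<^sub>X Y\<close>, which vanishes
  iff \<open>\<nabla>\<^sub>X Y\<close> is horizontal, and \<open>T\<^sub>V \<phi>W\<close> is the vertical part of \<open>\<phi> \<nabla>\<^sub>V W\<close>, which vanishes iff
  \<open>\<nabla>\<^sub>V W\<close> is vertical because \<open>\<nabla>\<^sub>V W\<close> is orthogonal to \<open>\<xi>\<close>.
\<close>

section \<open>Smooth functions and tangent spaces\<close>

text \<open>\<open>frechet_derivative\<close> is a choice among the maps satisfying
  \<open>has_derivative\<close>. Both functions have the same such maps, so the choices agree even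
  where no derivative exists.\<close>

lemma frechet_derivative_cong_open:
  assumes "open S" "x \<in> S" "\<And>y. y \<in> S \<Longrightarrow> f y = g y"
  shows "frechet_derivative f (at x) = frechet_derivative g (at x)"
proof -
  have "(f has_derivative f') (at x) \<longleftrightarrow> (g has_derivative f') (at x)" for f'
    using assms has_derivative_transform_within_open by metis
  then show ?thesis by (simp add: frechet_derivative_def)
qed

lemma Ck_on_cong:
  assumes "open S" "\<And>x. x \<in> S \<Longrightarrow> f x = g x" "Ck_on k S f"
  shows "Ck_on k S g"
  using assms(2,3)
proof (induction k arbitrary: f g)
  case 0
  then show ?case using continuous_on_cong by fastforce
next
  case (Suc k)
  have "g differentiable at x" if "x \<in> S" for x
    using Suc.prems that has_derivative_transform_within_open[OF _ assms(1) that, of f _ UNIV g]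
    unfolding differentiable_def Ck_on.simps by metis
  moreover have "Ck_on k S (\<lambda>x. frechet_derivative g (at x) u)" for u
  proof (rule Suc.IH)
    show "Ck_on k S (\<lambda>x. frechet_derivative f (at x) u)" using Suc.prems by simp
    show "frechet_derivative f (at x) u = frechet_derivative g (at x) u" if "x \<in> S" for x
      using frechet_derivative_cong_open[OF assms(1) that] Suc.prems(1) by metis
  qed
  ultimately show ?case by simp
qed

lemma frechet_derivative_diff:
  assumes "f differentiable at x" "g differentiable at x"
  shows "frechet_derivative (\<lambda>x. f x - g x) (at x) =
    (\<lambda>u. frechet_derivative f (at x) u - frechet_derivative g (at x) u)"
  by (rule frechet_derivative_at[symmetric], rule has_derivative_diff)
    (use assms frechet_derivative_works in blast)+

lemma Ck_on_diff:
  assumes "open S" "Ck_on k S f" "Ck_on k S g"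
  shows "Ck_on k S (\<lambda>x. f x - g x)"
  using assms(2,3)
proof (induction k arbitrary: f g)
  case 0
  then show ?case by (simp add: continuous_on_diff)
next
  case (Suc k)
  have "Ck_on k S (\<lambda>x. frechet_derivative (\<lambda>x. f x - g x) (at x) u)" for u
  \<comment> \<open>The derivative of the difference is known to split only at points of
    \<open>S\<close>, so the functions are compared on \<open>S\<close> and not rewritten
    globally.\<close>
  proof (rule Ck_on_cong[OF assms(1)])
    show "Ck_on k S (\<lambda>x. frechet_derivative f (at x) u - frechet_derivative g (at x) u)"
      using Suc by simp
    show "frechet_derivative f (at x) u - frechet_derivative g (at x) u =
        frechet_derivative (\<lambda>x. f x - g x) (at x) u" if "x \<in> S" for x
      using Suc.prems that by (simp add: frechet_derivative_diff)
  qed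
  then show ?case using Suc.prems by simp
qed

lemma Ck_on_const: "Ck_on k S (\<lambda>x. c)"
  by (induction k arbitrary: c) simp_all

section \<open>Smooth functions on a manifold\<close>

lemma smooth_manifold_chart:
  assumes "smooth_manifold A" "(U, \<psi>) \<in> A"
  shows "open U" "open (\<psi> ` U)" "homeomorphism U (\<psi> ` U) \<psi> (inv_into U \<psi>)"
  using assms unfolding smooth_manifold_def by auto

lemma smooth_functions_diff:
  assumes "smooth_manifold A" "f \<in> smooth_functions A" "g \<in> smooth_functions A"
  shows "(\<lambda>x. f x - g x) \<in> smooth_functions A"
proof -
  have "Ck_on k (\<psi> ` U) ((\<lambda>x. f x - g x) \<circ> inv_into U \<psi>)" if "(U, \<psi>) \<in> A" for U \<psi> k
  proof -
    have "Ck_on k (\<psi> ` U) (f \<circ> inv_into U \<psi>)" "Ck_on k (\<psi> ` U) (g \<circ> inv_into U \<psi>)"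
      using assms(2,3) that unfolding smooth_functions_def smooth_on_def by blast+
    from Ck_on_diff[OF smooth_manifold_chart(2)[OF assms(1) that] this]
    show ?thesis by (simp add: comp_def)
  qed
  then show ?thesis unfolding smooth_functions_def smooth_on_def by blast
qed

lemma smooth_functions_const: "(\<lambda>x. c) \<in> smooth_functions A"
  unfolding smooth_functions_def smooth_on_def comp_def by (auto simp: Ck_on_const)

lemma smooth_on_differentiable:
  assumes "smooth_on S f" "x \<in> S"
  shows "f differentiable at x"
proof -
  have "Ck_on (Suc 0) S f" using assms(1) unfolding smooth_on_def by blast
  then show ?thesis using assms(2) by simp
qed

lemma smooth_function_differentiable_chart:
  assumes "f \<in> smooth_functions A" "(U, \<psi>) \<in> A" "p \<in> U"
  shows "f \<circ> inv_into U \<psi> differentiable at (\<psi> p)"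
  by (rule smooth_on_differentiable[of "\<psi> ` U"]) (use assms in \<open>auto simp: smooth_functions_def\<close>)

section \<open>Tangent spaces as finite-dimensional vector spaces\<close>

lemma linear_chart_derivative:
  assumes "c \<in> A" "p \<in> fst c"
  shows "linear (chart_derivative A c p)"
proof
  fix u v :: 'b and r :: real
  have lin: "linear (frechet_derivative (f \<circ> inv_into (fst c) (snd c)) (at (snd c p)))"
    if "f \<in> smooth_functions A" for f
    using smooth_function_differentiable_chart[OF that, of "fst c" "snd c" p] assms
    by (simp add: linear_frechet_derivative)
  show "chart_derivative A c p (u + v) = chart_derivative A c p u + chart_derivative A c p v"
    unfolding chart_derivative_def plus_fun_def by (intro ext) (simp add: linear_add[OF lin])
  show "chart_derivative A c p (r *\<^sub>R u) = r *\<^sub>R chart_derivative A c p u"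
    unfolding chart_derivative_def scaleR_fun_def by (intro ext) (simp add: linear_scale[OF lin])
qed

text \<open>Chain rule: near \<open>\<theta> p\<close> the coordinate expression of \<open>f\<close>
  in the second chart is the one in the first chart composed with the transition map.\<close>

lemma chart_derivative_change_chart:
  assumes "smooth_manifold A" "(U, \<psi>) \<in> A" "p \<in> U" "(V, \<theta>) \<in> A" "p \<in> V"
  shows "chart_derivative A (V, \<theta>) p u = chart_derivative A (U, \<psi>) p
    (frechet_derivative (\<psi> \<circ> inv_into V \<theta>) (at (\<theta> p)) u)"
proof
  fix f
  let ?\<tau> = "\<psi> \<circ> inv_into V \<theta>"
  let ?S = "\<theta> ` (V \<inter> U)"
  note V = smooth_manifold_chart[OF assms(1,4)] and U = smooth_manifold_chart[OF assms(1,2)]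
  have inv: "inv_into V \<theta> (\<theta> q) = q" if "q \<in> V" for q
    using V(3) that by (simp add: homeomorphism_def)
  have invU: "inv_into U \<psi> (\<psi> q) = q" if "q \<in> U" for q
    using U(3) that by (simp add: homeomorphism_def)
  have "openin (top_of_set (\<theta> ` V)) ?S"
    by (rule homeomorphism_imp_open_map[OF V(3)]) (use U(1) in \<open>auto simp: openin_open\<close>)
  then have opS: "open ?S" using V(2) openin_open_eq by blast
  have pS: "\<theta> p \<in> ?S" using assms by blast
  have "smooth_on ?S ?\<tau>" using assms(1,2,4) unfolding smooth_manifold_def by fast
  then have d\<tau>: "?\<tau> differentiable at (\<theta> p)" using pS smooth_on_differentiable by blast
  have \<tau>p: "?\<tau> (\<theta> p) = \<psi> p" using inv assms(5) by simp
  show "chart_derivative A (V, \<theta>) p u f = chart_derivative A (U, \<psi>) p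
    (frechet_derivative ?\<tau> (at (\<theta> p)) u) f"
  proof (cases "f \<in> smooth_functions A")
    case True
    have df: "f \<circ> inv_into U \<psi> differentiable at (\<psi> p)"
      using smooth_function_differentiable_chart[OF True assms(2,3)] .
    have "frechet_derivative (f \<circ> inv_into V \<theta>) (at (\<theta> p)) =
        frechet_derivative ((f \<circ> inv_into U \<psi>) \<circ> ?\<tau>) (at (\<theta> p))"
      by (rule frechet_derivative_cong_open[OF opS pS]) (auto simp: inv invU)
    also have "\<dots> = frechet_derivative (f \<circ> inv_into U \<psi>) (at (?\<tau> (\<theta> p)))
        \<circ> frechet_derivative ?\<tau> (at (\<theta> p))"
      by (rule frechet_derivative_compose[OF d\<tau>]) (simp only: \<tau>p df)
    finally show ?thesis using True \<tau>p by (simp add: chart_derivative_def)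
  qed (simp add: chart_derivative_def)
qed

lemma chart_at:
  assumes "smooth_manifold A"
  obtains U \<psi> where "(U, \<psi>) \<in> A" "p \<in> U"
proof -
  have "p \<in> (\<Union>(U, \<psi>)\<in>A. U)" using assms unfolding smooth_manifold_def by simp
  then show thesis using that by auto
qed

text \<open>The definition collects derivatives from all charts around \<open>p\<close>. A change of
  chart moves them into one fixed chart, so the tangent space is the range of a single linear
  map.\<close>

lemma tangent_space_chart:
  assumes "smooth_manifold A" "(U, \<psi>) \<in> A" "p \<in> U"
  shows "tangent_space A p = range (chart_derivative A (U, \<psi>) p)"
proof
  show "tangent_space A p \<subseteq> range (chart_derivative A (U, \<psi>) p)"
    using chart_derivative_change_chart[OF assms] by (auto simp: tangent_space_def)
  show "range (chart_derivative A (U, \<psi>) p) \<subseteq> tangent_space A p"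
    using assms(2,3) unfolding tangent_space_def by force
qed

lemma tangent_space_finite_span:
  assumes "smooth_manifold A"
  obtains B where "finite B" "tangent_space A p = span B"
proof -
  obtain U \<psi> where c: "(U, \<psi>) \<in> A" "p \<in> U" using chart_at[OF assms] .
  let ?L = "chart_derivative A (U, \<psi>) p"
  have "linear ?L" using linear_chart_derivative c by fastforce
  then have "span (?L ` Basis) = ?L ` span Basis" by (rule linear_span_image)
  then have "tangent_space A p = span (?L ` Basis)" using tangent_space_chart[OF assms c] by simp
  then show thesis using that[of "?L ` Basis"] by simp
qed

lemma subspace_tangent_space: "smooth_manifold A \<Longrightarrow> subspace (tangent_space A p)"
  using tangent_space_finite_span subspace_span by metis

lemma tangent_vector_const:
  assumes "v \<in> tangent_space A p"
  shows "v (\<lambda>x. c) = 0"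
  using assms by (auto simp: tangent_space_def chart_derivative_def comp_def)

lemma tangent_vector_diff:
  assumes "smooth_manifold A" "v \<in> tangent_space A p"
    "f \<in> smooth_functions A" "g \<in> smooth_functions A"
  shows "v (\<lambda>x. f x - g x) = v f - v g"
proof -
  obtain U \<psi> u where c: "(U, \<psi>) \<in> A" "p \<in> U" and v: "v = chart_derivative A (U, \<psi>) p u"
    using assms(2) unfolding tangent_space_def by auto
  show ?thesis
    using assms(3,4) smooth_functions_diff[OF assms(1,3,4)]
      frechet_derivative_diff[OF smooth_function_differentiable_chart[OF assms(3) c]
        smooth_function_differentiable_chart[OF assms(4) c]]
    by (simp add: v chart_derivative_def comp_def)
qed

lemma tangent_vector_neg:
  assumes "smooth_manifold A" "v \<in> tangent_space A p" "f \<in> smooth_functions A"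
  shows "v (\<lambda>x. - f x) = - v f"
  using tangent_vector_diff[OF assms(1,2) smooth_functions_const assms(3), of 0]
    tangent_vector_const[OF assms(2)] by simp

section \<open>Smooth vector fields\<close>

lemma vector_fields_tangent: "X \<in> vector_fields A \<Longrightarrow> X p \<in> tangent_space A p"
  by (simp add: vector_fields_def)

lemma zero_vector_field:
  assumes "smooth_manifold A"
  shows "0 \<in> vector_fields A"
  using subspace_0[OF subspace_tangent_space[OF assms]]
  by (auto simp: vector_fields_def zero_fun_def smooth_functions_const)

lemma vector_fields_diff:
  assumes "smooth_manifold A" "X \<in> vector_fields A" "Y \<in> vector_fields A"
  shows "X - Y \<in> vector_fields A"
proof -
  have "X p - Y p \<in> tangent_space A p" for p
    using subspace_diff[OF subspace_tangent_space[OF assms(1)]] assms(2,3)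
    by (simp add: vector_fields_tangent)
  moreover have "(\<lambda>p. X p f - Y p f) \<in> smooth_functions A" if "f \<in> smooth_functions A" for f
    using smooth_functions_diff[OF assms(1)] assms(2,3) that by (simp add: vector_fields_def)
  ultimately show ?thesis by (simp add: vector_fields_def)
qed


section \<open>Orthogonal projections\<close>

text \<open>The ambient type is an infinite-dimensional function space in the application;
  finiteness comes from the bound on independent subsets of \<open>span B\<close>.\<close>

lemma finite_spanning_set_subspace:
  assumes "finite B" "subspace S" "S \<subseteq> span B"
  obtains C where "finite C" "S = span C"
proof -
  obtain C where C: "C \<subseteq> S" "independent C" "S \<subseteq> span C"
    using maximal_independent_subset by blast
  have "finite C" using independent_span_bound[OF assms(1) C(2)] C(1) assms(3) by auto
  moreover have "S = span C" using C assms(2) span_minimal by blast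
  ultimately show thesis using that by blast
qed

text \<open>A metric is constrained only on tangent spaces, which are subspaces of a larger function
  space. The form is therefore positive definite on \<open>T\<close> alone, and every rule carries
  membership conditions.\<close>

locale inner_product_on =
  fixes T :: "'v::real_vector set" and ip :: "'v \<Rightarrow> 'v \<Rightarrow> real"
  assumes subspace: "subspace T"
    and commute: "v \<in> T \<Longrightarrow> w \<in> T \<Longrightarrow> ip v w = ip w v"
    and add_left: "u \<in> T \<Longrightarrow> v \<in> T \<Longrightarrow> w \<in> T \<Longrightarrow> ip (u + v) w = ip u w + ip v w"
    and scale_left: "v \<in> T \<Longrightarrow> w \<in> T \<Longrightarrow> ip (c *\<^sub>R v) w = c * ip v w"
    and pos: "v \<in> T \<Longrightarrow> v \<noteq> 0 \<Longrightarrow> ip v v > 0"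
begin

lemmas closed = subspace_add[OF subspace] subspace_scale[OF subspace] subspace_0[OF subspace]
  subspace_diff[OF subspace] subspace_neg[OF subspace]

lemma zero_left: "w \<in> T \<Longrightarrow> ip 0 w = 0"
  using scale_left[of w w 0] by simp

lemma neg_left: "v \<in> T \<Longrightarrow> w \<in> T \<Longrightarrow> ip (- v) w = - ip v w"
  using scale_left[of v w "-1"] by simp

lemma diff_left: "u \<in> T \<Longrightarrow> v \<in> T \<Longrightarrow> w \<in> T \<Longrightarrow> ip (u - v) w = ip u w - ip v w"
  using add_left[of u "- v" w] neg_left by (simp add: closed)

lemma zero_right: "w \<in> T \<Longrightarrow> ip w 0 = 0"
  using zero_left commute closed by metis

lemma add_right: "u \<in> T \<Longrightarrow> v \<in> T \<Longrightarrow> w \<in> T \<Longrightarrow> ip w (u + v) = ip w u + ip w v"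
  using add_left commute closed by metis

lemma scale_right: "v \<in> T \<Longrightarrow> w \<in> T \<Longrightarrow> ip w (c *\<^sub>R v) = c * ip w v"
  using scale_left commute closed by metis

lemma diff_right: "u \<in> T \<Longrightarrow> v \<in> T \<Longrightarrow> w \<in> T \<Longrightarrow> ip w (u - v) = ip w u - ip w v"
  using diff_left commute closed by metis

lemma eq_zero: "v \<in> T \<Longrightarrow> ip v v = 0 \<Longrightarrow> v = 0"
  using pos by fastforce

lemma orthogonal_span:
  assumes "B \<subseteq> T" "v \<in> T" "\<And>b. b \<in> B \<Longrightarrow> ip v b = 0" "u \<in> span B"
  shows "ip v u = 0"
proof -
  have "span B \<subseteq> T" using assms(1) subspace span_minimal by blast
  \<comment> \<open>Membership in \<open>T\<close> is carried through the induction because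
    linearity of \<open>ip\<close> is available only there.\<close>
  have "u \<in> T \<and> ip v u = 0"
    using assms(4)
  proof (induction rule: span_induct_alt)
    case base
    then show ?case using zero_right assms(2) closed by simp
  next
    case (step c x y)
    then show ?case using assms(1-3) by (auto simp: closed add_right scale_right)
  qed
  then show ?thesis ..
qed

text \<open>Gram-Schmidt by induction on the spanning set: the new vector \<open>b\<close> is
  replaced by its part \<open>e\<close> orthogonal to the old span, and the old projection is
  corrected along \<open>e\<close>.\<close>

lemma projection_exists:
  assumes "finite B" "B \<subseteq> T" "v \<in> T"
  shows "\<exists>w\<in>span B. \<forall>u\<in>span B. ip (v - w) u = 0"
  using assms
proof (induction B arbitrary: v)
  case empty
  then show ?case by (simp add: zero_right)
next
  case (insert b B)
  have spT: "span B \<subseteq> T" using insert.prems subspace span_minimal by blast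
  obtain b' where b': "b' \<in> span B" "\<And>u. u \<in> span B \<Longrightarrow> ip (b - b') u = 0"
    using insert.IH[of b] insert.prems by (meson insert_subset)
  obtain w where w: "w \<in> span B" "\<And>u. u \<in> span B \<Longrightarrow> ip (v - w) u = 0"
    using insert.IH[of v] insert.prems by (meson insert_subset)
  define e where "e = b - b'"
  have T: "b \<in> T" "b' \<in> T" "w \<in> T" "e \<in> T" "v - w \<in> T"
    using insert.prems spT b' w closed by (auto simp: e_def)
  \<comment> \<open>If \<open>b\<close> already lies in the old span, then \<open>e = 0\<close>, the
    quotient is 0 by convention, and \<open>x = w\<close> remains correct.\<close>
  define x where "x = w + (ip (v - w) e / ip e e) *\<^sub>R e"
  have xT: "x \<in> T" using T closed by (simp add: x_def)
  have "v - x = (v - w) - (ip (v - w) e / ip e e) *\<^sub>R e" by (simp add: x_def)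
  then have ip_vx: "ip (v - x) u = ip (v - w) u - ip (v - w) e / ip e e * ip e u"
    if "u \<in> T" for u
    using diff_left[OF T(5) _ that] scale_left[OF T(4) that] closed(2)[OF T(4)] by metis
  have orthB: "ip (v - x) u = 0" if "u \<in> span B" for u
    using ip_vx[of u] that b'(2) w(2) spT by (auto simp flip: e_def)
  have orthe: "ip (v - x) e = 0"
    using ip_vx[OF T(4)] eq_zero[OF T(4)] zero_right[OF T(5)] by (cases "ip e e = 0") auto
  have "v - x \<in> T" using xT insert.prems(2) closed(4) by blast
  \<comment> \<open>Here \<open>e + b'\<close> is just \<open>b\<close>, so orthogonality to
    \<open>b\<close> follows from that to its two parts.\<close>
  have "ip (v - x) (e + b') = ip (v - x) e + ip (v - x) b'"
    using add_right[OF T(4,2) \<open>v - x \<in> T\<close>] .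
  then have orthb: "ip (v - x) b = 0"
    using orthe orthB[OF b'(1)] by (simp add: e_def)
  have "ip (v - x) u = 0" if "u \<in> insert b B" for u
    using that orthb orthB span_base by blast
  then have "\<forall>u\<in>span (insert b B). ip (v - x) u = 0"
    using orthogonal_span[OF insert.prems(1) \<open>v - x \<in> T\<close>] by blast
  moreover have "e \<in> span (insert b B)" "w \<in> span (insert b B)"
    using w(1) b'(1) span_mono[OF subset_insertI, of B b] span_base[of b "insert b B"] span_diff
    unfolding e_def by blast+
  then have "x \<in> span (insert b B)" unfolding x_def by (simp add: span_add span_scale)
  ultimately show ?case by (rule bexI[where x = x])
qed

text \<open>\<open>orth_proj\<close> is a definite description, so uniqueness is needed: the
  difference of two candidates lies in \<open>S\<close> and is orthogonal to \<open>S\<close>, hence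
  to itself.\<close>

lemma orth_proj_eqI:
  assumes "subspace S" "S \<subseteq> T" "v \<in> T" "w \<in> S" "\<And>u. u \<in> S \<Longrightarrow> ip (v - w) u = 0"
  shows "orth_proj ip S v = w"
  unfolding orth_proj_def
proof (rule the_equality)
  show "w \<in> S \<and> (\<forall>u\<in>S. ip (v - w) u = 0)" using assms by blast
next
  fix w' assume w': "w' \<in> S \<and> (\<forall>u\<in>S. ip (v - w') u = 0)"
  have d: "w' - w \<in> S" using w' assms(1,4) subspace_diff by blast
  have "v - w \<in> T" "v - w' \<in> T" "w' - w \<in> T"
    using assms(2-4) w' d closed(4) by blast+
  then have "ip ((v - w) - (v - w')) (w' - w) = ip (v - w) (w' - w) - ip (v - w') (w' - w)"
    by (rule diff_left)
  also have "\<dots> = 0" using d w' assms(5) by simp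
  finally have "ip (w' - w) (w' - w) = 0" by simp
  then show "w' = w" using eq_zero d assms(2) by force
qed

lemma orth_proj_self:
  assumes "subspace S" "S \<subseteq> T" "v \<in> S"
  shows "orth_proj ip S v = v"
  using assms zero_left by (intro orth_proj_eqI) auto

lemma orth_proj_orthogonal:
  assumes "subspace S" "S \<subseteq> T" "v \<in> T" "\<And>u. u \<in> S \<Longrightarrow> ip v u = 0"
  shows "orth_proj ip S v = 0"
  using assms subspace_0 by (intro orth_proj_eqI) auto

lemma subspace_complement:
  assumes "S \<subseteq> T"
  shows "subspace {v \<in> T. \<forall>w\<in>S. ip v w = 0}"
proof (rule subspaceI)
  show "0 \<in> {v \<in> T. \<forall>w\<in>S. ip v w = 0}" using assms closed(3) zero_left by blast
  show "x + y \<in> {v \<in> T. \<forall>w\<in>S. ip v w = 0}"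
    if "x \<in> {v \<in> T. \<forall>w\<in>S. ip v w = 0}" "y \<in> {v \<in> T. \<forall>w\<in>S. ip v w = 0}" for x y
    using that assms closed(1) add_left by (simp add: subset_iff)
  show "c *\<^sub>R x \<in> {v \<in> T. \<forall>w\<in>S. ip v w = 0}"
    if "x \<in> {v \<in> T. \<forall>w\<in>S. ip v w = 0}" for x c
    using that assms closed(2) scale_left by (simp add: subset_iff)
qed

context
  fixes B S
  assumes finite_span: "finite B" "T = span B" and S: "subspace S" "S \<subseteq> T"
begin

lemma orth_decomposition:
  assumes "v \<in> T"
  obtains w where "w \<in> S" "\<And>u. u \<in> S \<Longrightarrow> ip (v - w) u = 0"
proof -
  obtain C where C: "finite C" "S = span C"
    using finite_spanning_set_subspace[OF finite_span(1) S(1)] S(2) finite_span(2) by blast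
  then have "C \<subseteq> T" using S(2) span_superset by blast
  then show thesis using projection_exists[OF C(1) _ assms] C(2) that by blast
qed

lemma orth_proj_eq_0_iff:
  assumes "v \<in> T"
  shows "orth_proj ip S v = 0 \<longleftrightarrow> (\<forall>u\<in>S. ip v u = 0)"
proof
  obtain w where w: "w \<in> S" "\<And>u. u \<in> S \<Longrightarrow> ip (v - w) u = 0"
    using orth_decomposition[OF assms] by blast
  moreover assume "orth_proj ip S v = 0"
  ultimately have "w = 0" using orth_proj_eqI[OF S assms w] by simp
  then show "\<forall>u\<in>S. ip v u = 0" using w(2) by simp
qed (use orth_proj_orthogonal[OF S assms] in blast)

text \<open>If \<open>w\<close> is the component of \<open>v\<close> in \<open>S\<close>, the
  projection to the complement is \<open>v - w\<close>; it vanishes exactly when \<open>v\<close>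
  equals its own component.\<close>

lemma orth_proj_complement_eq_0_iff:
  assumes "v \<in> T"
  shows "orth_proj ip {v \<in> T. \<forall>w\<in>S. ip v w = 0} v = 0 \<longleftrightarrow> v \<in> S" (is "orth_proj ip ?H v = 0 \<longleftrightarrow> _")
proof -
  obtain w where w: "w \<in> S" "\<And>u. u \<in> S \<Longrightarrow> ip (v - w) u = 0"
    using orth_decomposition[OF assms] by blast
  have H: "subspace ?H" "?H \<subseteq> T"
    using subspace_complement[OF S(2)] by blast+
  have wT: "w \<in> T" using w(1) S(2) by blast
  have "orth_proj ip ?H v = v - w"
  proof (rule orth_proj_eqI[OF H assms])
    show "v - w \<in> ?H" using w(2) closed(4)[OF assms wT] by simp
    show "ip (v - (v - w)) u = 0" if "u \<in> ?H" for u
      using that w(1) wT commute[of w u] by simp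
  qed
  moreover have "v = w" if "v \<in> S"
  proof -
    have "v - w \<in> S" using w(1) that S(1) subspace_diff by blast
    then have "v - w = 0" using w(2) S(2) eq_zero by blast
    then show ?thesis by simp
  qed
  ultimately show ?thesis using w(1) by auto
qed

end

end


section \<open>The structure equation of a cosymplectic manifold\<close>

text \<open>From here on the simplifier discharges the tangency conditions of the pointwise
  rules.\<close>

declare vector_fields_tangent [simp]

section \<open>The Levi-Civita connection on a Riemannian manifold\<close>

locale riemannian_manifold =
  fixes A :: "('m::{t2_space, second_countable_topology}, 'e::euclidean_space) atlas"
    and g :: "'m bilinear_form"
    and nab :: "'m vector_field \<Rightarrow> 'm vector_field \<Rightarrow> 'm vector_field"
  assumes manifold: "smooth_manifold A"
    and metric: "riemannian_metric A g"
    and levi_civita: "levi_civita A g nab"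
begin

sublocale inner_product_on "tangent_space A p" "g p" for p
  using metric subspace_tangent_space[OF manifold]
  by unfold_locales (simp_all add: riemannian_metric_def)

lemma nab_vector_field [simp]:
  "X \<in> vector_fields A \<Longrightarrow> Y \<in> vector_fields A \<Longrightarrow> nab X Y \<in> vector_fields A"
  using levi_civita by (simp add: levi_civita_def)

lemma nab_add_left:
  "X \<in> vector_fields A \<Longrightarrow> Y \<in> vector_fields A \<Longrightarrow> Z \<in> vector_fields A \<Longrightarrow>
    nab (X + Y) Z = nab X Z + nab Y Z"
  using levi_civita unfolding levi_civita_def by blast

lemma nab_add_right:
  "X \<in> vector_fields A \<Longrightarrow> Y \<in> vector_fields A \<Longrightarrow> Z \<in> vector_fields A \<Longrightarrow>
    nab X (Y + Z) = nab X Y + nab X Z"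
  using levi_civita unfolding levi_civita_def by blast

lemma nab_fmult_left:
  "h \<in> smooth_functions A \<Longrightarrow> X \<in> vector_fields A \<Longrightarrow> Y \<in> vector_fields A \<Longrightarrow>
    nab (fmult h X) Y = fmult h (nab X Y)"
  using levi_civita unfolding levi_civita_def by blast

lemma nab_fmult_right:
  "h \<in> smooth_functions A \<Longrightarrow> X \<in> vector_fields A \<Longrightarrow> Y \<in> vector_fields A \<Longrightarrow>
    nab X (fmult h Y) = fmult (vderiv X h) Y + fmult h (nab X Y)"
  using levi_civita unfolding levi_civita_def by blast

lemma lie_bracket_nab:
  "X \<in> vector_fields A \<Longrightarrow> Y \<in> vector_fields A \<Longrightarrow> lie_bracket X Y p = nab X Y p - nab Y X p"
  using levi_civita unfolding levi_civita_def by (metis minus_apply)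

lemma metric_compatible:
  assumes "X \<in> vector_fields A" "Y \<in> vector_fields A" "Z \<in> vector_fields A"
  shows "X p (\<lambda>q. g q (Y q) (Z q)) = g p (nab X Y p) (Z p) + g p (Y p) (nab X Z p)"
proof -
  have "vderiv X (fform2 g Y Z) = fform2 g (nab X Y) Z + fform2 g Y (nab X Z)"
    using levi_civita assms unfolding levi_civita_def by blast
  from fun_cong[OF this, of p] show ?thesis by (simp add: vderiv_def fform2_def)
qed

lemma nab_zero_left [simp]:
  assumes "Y \<in> vector_fields A"
  shows "nab 0 Y = 0"
proof -
  have "nab (0 + 0) Y = nab 0 Y + nab 0 Y"
    by (intro nab_add_left zero_vector_field manifold assms)
  then show ?thesis by simp
qed

lemma nab_zero_right [simp]:
  assumes "X \<in> vector_fields A"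
  shows "nab X 0 = 0"
proof -
  have "nab X (0 + 0) = nab X 0 + nab X 0"
    by (intro nab_add_right zero_vector_field manifold assms)
  then show ?thesis by simp
qed

lemma metric_smooth:
  "X \<in> vector_fields A \<Longrightarrow> Y \<in> vector_fields A \<Longrightarrow>
    (\<lambda>p. g p (X p) (Y p)) \<in> smooth_functions A"
  using metric by (simp add: riemannian_metric_def)

text \<open>Torsion-freeness turns the bracket into \<open>nab X Y - nab Y X\<close>, so closure
  under covariant differentiation already gives involutivity.\<close>

lemma totally_geodesic_foliation_iff:
  assumes "\<And>p. subspace (D p)"
  shows "totally_geodesic_foliation A nab D \<longleftrightarrow>
    (\<forall>X\<in>sections A D. \<forall>Y\<in>sections A D. \<forall>p. nab X Y p \<in> D p)"
proof -
  have "lie_bracket X Y \<in> sections A D"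
    if geodesic: "\<forall>X\<in>sections A D. \<forall>Y\<in>sections A D. \<forall>p. nab X Y p \<in> D p"
      and XY: "X \<in> sections A D" "Y \<in> sections A D" for X Y
  proof -
    have vf: "X \<in> vector_fields A" "Y \<in> vector_fields A" using XY by (simp_all add: sections_def)
    have "lie_bracket X Y = nab X Y - nab Y X"
      using lie_bracket_nab[OF vf] by (intro ext) simp
    moreover have "nab X Y - nab Y X \<in> vector_fields A"
      using vf by (intro vector_fields_diff[OF manifold]) simp_all
    moreover have "nab X Y p - nab Y X p \<in> D p" for p
      using geodesic XY by (intro subspace_diff[OF assms]) blast+
    ultimately show ?thesis by (simp add: sections_def)
  qed
  moreover have "nab X Y \<in> sections A D \<longleftrightarrow> (\<forall>p. nab X Y p \<in> D p)"
    if "X \<in> sections A D" "Y \<in> sections A D" for X Y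
    using that by (simp add: sections_def)
  ultimately show ?thesis unfolding totally_geodesic_foliation_def by blast
qed

end

section \<open>Pointwise algebra of the almost contact metric structure\<close>

locale cosymplectic_manifold = riemannian_manifold A g nab
  for A :: "('m::{t2_space, second_countable_topology}, 'e::euclidean_space) atlas" and g nab +
  fixes \<phi> :: "'m endomorphism_field" and \<xi> :: "'m vector_field" and \<eta> :: "'m one_form"
  assumes cosymplectic: "cosymplectic A \<phi> \<xi> \<eta> g"
begin

abbreviation J :: "'m vector_field \<Rightarrow> 'm vector_field"
  where "J \<equiv> tapply \<phi>"

lemma J_apply [simp]: "J X p = \<phi> p (X p)"
  by (simp add: tapply_def)

lemma contact: "almost_contact_metric A \<phi> \<xi> \<eta> g"
  using cosymplectic by (simp add: cosymplectic_def)

lemma J_vector_field [simp]: "X \<in> vector_fields A \<Longrightarrow> J X \<in> vector_fields A"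
  using contact unfolding almost_contact_metric_def smooth_endomorphism_field_def tapply_def by blast

lemma \<xi>_vector_field [simp]: "\<xi> \<in> vector_fields A"
  using contact unfolding almost_contact_metric_def by blast

lemma \<phi>_tangent [simp]: "v \<in> tangent_space A p \<Longrightarrow> \<phi> p v \<in> tangent_space A p"
  using contact unfolding almost_contact_metric_def smooth_endomorphism_field_def by blast

lemma \<phi>_add: "v \<in> tangent_space A p \<Longrightarrow> w \<in> tangent_space A p \<Longrightarrow>
    \<phi> p (v + w) = \<phi> p v + \<phi> p w"
  using contact unfolding almost_contact_metric_def smooth_endomorphism_field_def by blast

lemma \<phi>_scale: "v \<in> tangent_space A p \<Longrightarrow> \<phi> p (c *\<^sub>R v) = c *\<^sub>R \<phi> p v"
  using contact unfolding almost_contact_metric_def smooth_endomorphism_field_def by blast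

lemma \<phi>_neg: "v \<in> tangent_space A p \<Longrightarrow> \<phi> p (- v) = - \<phi> p v"
  using \<phi>_scale[of v p "-1"] by simp

lemma \<phi>_zero [simp]: "\<phi> p 0 = 0"
  using \<phi>_scale[of 0 p 0] closed(3) by simp

lemma \<phi>_diff: "v \<in> tangent_space A p \<Longrightarrow> w \<in> tangent_space A p \<Longrightarrow>
    \<phi> p (v - w) = \<phi> p v - \<phi> p w"
  using \<phi>_add[of v p "- w"] \<phi>_neg closed(5) by simp

lemma \<phi>_\<phi>: "v \<in> tangent_space A p \<Longrightarrow> \<phi> p (\<phi> p v) = - v + \<eta> p v *\<^sub>R \<xi> p"
  using contact unfolding almost_contact_metric_def by blast

lemma \<phi>_\<xi> [simp]: "\<phi> p (\<xi> p) = 0"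
  using contact unfolding almost_contact_metric_def by blast

lemma \<eta>_\<phi> [simp]: "v \<in> tangent_space A p \<Longrightarrow> \<eta> p (\<phi> p v) = 0"
  using contact unfolding almost_contact_metric_def by blast

lemma \<eta>_eq: "v \<in> tangent_space A p \<Longrightarrow> \<eta> p v = g p v (\<xi> p)"
  using contact unfolding almost_contact_metric_def by blast

lemma g_\<xi>_\<xi>: "g p (\<xi> p) (\<xi> p) = 1"
proof -
  have "\<eta> p (\<xi> p) = 1" using contact unfolding almost_contact_metric_def by blast
  then show ?thesis using \<eta>_eq[of "\<xi> p" p] by simp
qed

lemma g_\<phi>_\<phi>: "v \<in> tangent_space A p \<Longrightarrow> w \<in> tangent_space A p \<Longrightarrow>
    g p (\<phi> p v) (\<phi> p w) = g p v w - \<eta> p v * \<eta> p w"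
  using contact unfolding almost_contact_metric_def by blast

text \<open>Compatibility is applied to \<open>v\<close> and \<open>\<phi> p w\<close>, then
  \<open>\<phi>\<close> squared is expanded; both correction terms die because \<eta> vanishes on
  the image of \<phi>.\<close>

lemma \<phi>_skew:
  assumes "v \<in> tangent_space A p" "w \<in> tangent_space A p"
  shows "g p v (\<phi> p w) = - g p (\<phi> p v) w"
proof -
  have "g p v (\<phi> p w) = g p (\<phi> p v) (\<phi> p (\<phi> p w))"
    using g_\<phi>_\<phi>[of v p "\<phi> p w"] assms by simp
  also have "\<dots> = - g p (\<phi> p v) w + \<eta> p w * g p (\<phi> p v) (\<xi> p)"
    using assms by (simp add: \<phi>_\<phi> diff_right scale_right closed)
  also have "g p (\<phi> p v) (\<xi> p) = 0" using \<eta>_eq[of "\<phi> p v" p] assms by simp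
  finally show ?thesis by simp
qed

section \<open>The covariant derivative \<open>(\<nabla>\<^sub>X \<phi>)Y\<close> and its
  symmetries\<close>

definition nab_\<phi> :: "'m vector_field \<Rightarrow> 'm vector_field \<Rightarrow> 'm vector_field"
  where "nab_\<phi> X Y = nab X (J Y) - J (nab X Y)"

lemma nab_\<phi>_vector_field [simp]:
  "X \<in> vector_fields A \<Longrightarrow> Y \<in> vector_fields A \<Longrightarrow> nab_\<phi> X Y \<in> vector_fields A"
  using vector_fields_diff[OF manifold] by (simp add: nab_\<phi>_def)

lemma nab_\<phi>_apply: "nab_\<phi> X Y p = nab X (J Y) p - \<phi> p (nab X Y p)"
  by (simp add: nab_\<phi>_def)

text \<open>Skewness moves \<phi> to the other argument, leaving only the terms that metric
  compatibility and the closed fundamental form produce.\<close>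

lemma g_nab_\<phi>:
  assumes "X \<in> vector_fields A" "Y \<in> vector_fields A" "Z \<in> vector_fields A"
  shows "g p (nab_\<phi> X Y p) (Z p) = g p (nab X (J Y) p) (Z p) + g p (nab X Y p) (J Z p)"
  using assms \<phi>_skew[of "nab X Y p" p "Z p"] by (simp add: nab_\<phi>_apply diff_left)

text \<open>The derivative of a skew endomorphism is skew: differentiate
  \<open>g (Y) (J Z) = - g (J Y) (Z)\<close> along \<open>X\<close> on both sides.\<close>

lemma nab_\<phi>_skew:
  assumes "X \<in> vector_fields A" "Y \<in> vector_fields A" "Z \<in> vector_fields A"
  shows "g p (nab_\<phi> X Y p) (Z p) = - g p (nab_\<phi> X Z p) (Y p)"
proof -
  have "X p (\<lambda>q. g q (Y q) (J Z q)) = X p (\<lambda>q. - g q (J Y q) (Z q))"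
    using \<phi>_skew assms by simp
  moreover have "X p (\<lambda>q. - g q (J Y q) (Z q)) = - X p (\<lambda>q. g q (J Y q) (Z q))"
    using tangent_vector_neg[OF manifold vector_fields_tangent metric_smooth[of "J Y" Z]] assms
    by (simp del: J_apply)
  moreover have "X p (\<lambda>q. g q (J Y q) (Z q)) = g p (nab X (J Y) p) (Z p) + g p (J Y p) (nab X Z p)"
    using assms metric_compatible[of X "J Y" Z p] by (simp del: J_apply)
  moreover have "X p (\<lambda>q. g q (Y q) (J Z q)) = g p (nab X Y p) (J Z p) + g p (Y p) (nab X (J Z) p)"
    using assms metric_compatible[of X Y "J Z" p] by (simp del: J_apply)
  moreover have "g p (Y p) (nab X (J Z) p) = g p (nab X (J Z) p) (Y p)"
    "g p (J Y p) (nab X Z p) = g p (nab X Z p) (J Y p)"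
    using assms by (simp_all add: commute)
  ultimately show ?thesis
    unfolding g_nab_\<phi>[OF assms] g_nab_\<phi>[OF assms(1,3,2)] by linarith
qed

lemma nab_\<phi>_cyclic:
  assumes "X \<in> vector_fields A" "Y \<in> vector_fields A" "Z \<in> vector_fields A"
  shows "g p (nab_\<phi> X Y p) (Z p) + g p (nab_\<phi> Y Z p) (X p) + g p (nab_\<phi> Z X p) (Y p) = 0"
proof -
  \<comment> \<open>With \<open>X\<close> and \<open>Y\<close> swapped, \<open>X\<close>
    differentiates the pairing of \<open>Z\<close> with \<open>J Y\<close>. This yields
    \<open>nab X (J Y)\<close> against \<open>Z\<close>, as the cyclic sum requires.\<close>
  have "ext_deriv2 (fundamental_form \<phi> g) Y X Z = 0"
    using cosymplectic assms unfolding cosymplectic_def by blast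
  from fun_cong[OF this, of p]
  have d\<Phi>: "Y p (\<lambda>q. g q (X q) (J Z q)) + X p (\<lambda>q. g q (Z q) (J Y q)) + Z p (\<lambda>q. g q (Y q) (J X q))
     - g p (lie_bracket Y X p) (J Z p) - g p (lie_bracket X Z p) (J Y p)
     - g p (lie_bracket Z Y p) (J X p) = 0"
    by (simp add: ext_deriv2_def vderiv_def fform2_def fundamental_form_def)
  have deriv: "X p (\<lambda>q. g q (Y q) (J Z q)) = g p (nab X Y p) (J Z p) + g p (nab X (J Z) p) (Y p)"
    if "X \<in> vector_fields A" "Y \<in> vector_fields A" "Z \<in> vector_fields A" for X Y Z
    using that metric_compatible[of X Y "J Z" p] commute[of "Y p" p "nab X (J Z) p"]
    by (simp del: J_apply)
  have bracket: "g p (lie_bracket X Y p) (J Z p) = g p (nab X Y p) (J Z p) - g p (nab Y X p) (J Z p)"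
    if "X \<in> vector_fields A" "Y \<in> vector_fields A" "Z \<in> vector_fields A" for X Y Z
    using that by (simp add: lie_bracket_nab diff_left)
  show ?thesis
    using d\<Phi> unfolding deriv[OF assms(2,1,3)] deriv[OF assms(1,3,2)] deriv[OF assms(3,2,1)]
      bracket[OF assms(2,1,3)] bracket[OF assms(1,3,2)] bracket[OF assms(3,2,1)]
      g_nab_\<phi>[OF assms] g_nab_\<phi>[OF assms(2,3,1)] g_nab_\<phi>[OF assms(3,1,2)]
    by linarith
qed

text \<open>The coefficient is written with the metric instead of \<eta>, so that
  \<open>metric_smooth\<close> and metric compatibility apply to it.\<close>

lemma J_J: "X \<in> vector_fields A \<Longrightarrow> J (J X) + X = fmult (\<lambda>p. g p (X p) (\<xi> p)) \<xi>"
  by (simp add: fun_eq_iff fmult_def \<phi>_\<phi> \<eta>_eq)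

text \<open>This is the covariant derivative of
  \<open>\<phi>\<^sup>2 = -I + \<eta> \<otimes> \<xi>\<close>: the left side is the product rule for
  the square, and the first coefficient on the right is
  \<open>(\<nabla>\<^sub>X \<eta>)(Y)\<close>.\<close>

lemma nab_\<phi>_J:
  assumes "X \<in> vector_fields A" "Y \<in> vector_fields A"
  shows "nab_\<phi> X (J Y) p + \<phi> p (nab_\<phi> X Y p) =
    g p (Y p) (nab X \<xi> p) *\<^sub>R \<xi> p + \<eta> p (Y p) *\<^sub>R nab X \<xi> p"
proof -
  have "nab X (J (J Y)) + nab X Y = nab X (fmult (\<lambda>p. g p (Y p) (\<xi> p)) \<xi>)"
    using assms nab_add_right[of X "J (J Y)" Y] J_J by simp
  also have "\<dots> = fmult (vderiv X (\<lambda>p. g p (Y p) (\<xi> p))) \<xi>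
      + fmult (\<lambda>p. g p (Y p) (\<xi> p)) (nab X \<xi>)"
    using assms by (simp add: nab_fmult_right metric_smooth)
  finally have nab_sum: "nab X (J (J Y)) + nab X Y = fmult (vderiv X (\<lambda>p. g p (Y p) (\<xi> p))) \<xi>
      + fmult (\<lambda>p. g p (Y p) (\<xi> p)) (nab X \<xi>)" .
  have "nab X (J (J Y)) p + nab X Y p =
      X p (\<lambda>q. g q (Y q) (\<xi> q)) *\<^sub>R \<xi> p + \<eta> p (Y p) *\<^sub>R nab X \<xi> p"
    using assms fun_cong[OF nab_sum, of p] by (simp add: fmult_def vderiv_def \<eta>_eq)
  then have "nab X (J (J Y)) p = X p (\<lambda>q. g q (Y q) (\<xi> q)) *\<^sub>R \<xi> p
      + \<eta> p (Y p) *\<^sub>R nab X \<xi> p - nab X Y p"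
    by (simp add: eq_diff_eq)
  moreover have "nab_\<phi> X (J Y) p + \<phi> p (nab_\<phi> X Y p) =
      nab X (J (J Y)) p + nab X Y p - \<eta> p (nab X Y p) *\<^sub>R \<xi> p"
    using assms by (simp add: nab_\<phi>_apply \<phi>_diff \<phi>_\<phi>)
  moreover have "X p (\<lambda>q. g q (Y q) (\<xi> q)) = \<eta> p (nab X Y p) + g p (Y p) (nab X \<xi> p)"
    using assms by (simp add: metric_compatible \<eta>_eq)
  ultimately show ?thesis by (simp add: scaleR_add_left)
qed

text \<open>As \<eta> is closed, normality reduces to a vanishing Nijenhuis tensor; expanding its
  brackets by the torsion-free connection groups the terms into \<open>nab_\<phi>\<close>.\<close>

lemma normality:
  assumes "X \<in> vector_fields A" "Y \<in> vector_fields A"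
  shows "nab_\<phi> (J X) Y p - nab_\<phi> (J Y) X p = \<phi> p (nab_\<phi> X Y p) - \<phi> p (nab_\<phi> Y X p)"
proof -
  have normal: "nijenhuis \<phi> X Y + fmult (\<lambda>p. 2 * ext_deriv1 \<eta> X Y p) \<xi> = 0"
    and closed: "ext_deriv1 \<eta> X Y = 0"
    using cosymplectic assms unfolding cosymplectic_def by blast+
  have nij_0: "nijenhuis \<phi> X Y p = 0"
    using fun_cong[OF normal, of p] fun_cong[OF closed, of p] by (simp add: fmult_def)
  have nij: "nijenhuis \<phi> X Y p = \<phi> p (\<phi> p (nab X Y p)) - \<phi> p (\<phi> p (nab Y X p))
     + (nab (J X) (J Y) p - nab (J Y) (J X) p)
     - (\<phi> p (nab (J X) Y p) - \<phi> p (nab Y (J X) p))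
     - (\<phi> p (nab X (J Y) p) - \<phi> p (nab (J Y) X p))"
    using assms by (simp add: nijenhuis_def lie_bracket_nab \<phi>_diff)
  have \<phi>_nab_\<phi>: "\<phi> p (nab_\<phi> X Y p) = \<phi> p (nab X (J Y) p) - \<phi> p (\<phi> p (nab X Y p))"
    "\<phi> p (nab_\<phi> Y X p) = \<phi> p (nab Y (J X) p) - \<phi> p (\<phi> p (nab Y X p))"
    using assms by (simp_all add: nab_\<phi>_apply \<phi>_diff)
  \<comment> \<open>A pure rearrangement in an abelian group, with the variables standing for the
    eight summands of \<open>nij\<close>.\<close>
  have "(c - e) - (d - k) - ((h - a) - (f - b)) = a - b + (c - d) - (e - f) - (h - k)"
    for a b c d e f h k :: "'m tangent_vector"
    by (simp add: algebra_simps)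
  then have "nab_\<phi> (J X) Y p - nab_\<phi> (J Y) X p - (\<phi> p (nab_\<phi> X Y p) - \<phi> p (nab_\<phi> Y X p)) =
      nijenhuis \<phi> X Y p"
    unfolding nij \<phi>_nab_\<phi> nab_\<phi>_apply[of "J X" Y p] nab_\<phi>_apply[of "J Y" X p] .
  then show ?thesis using nij_0 by (simp only: right_minus_eq)
qed

section \<open>Vanishing of the covariant derivative of \<xi>\<close>

lemma nab_\<xi>_symmetric:
  assumes "X \<in> vector_fields A" "Y \<in> vector_fields A"
  shows "g p (Y p) (nab X \<xi> p) = g p (X p) (nab Y \<xi> p)"
proof -
  have "ext_deriv1 \<eta> X Y = 0"
    using cosymplectic assms unfolding cosymplectic_def by blast
  from fun_cong[OF this, of p]
  have "X p (\<lambda>q. g q (Y q) (\<xi> q)) - Y p (\<lambda>q. g q (X q) (\<xi> q)) - g p (lie_bracket X Y p) (\<xi> p) = 0"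
    using assms closed(4) by (simp add: ext_deriv1_def vderiv_def fform_def \<eta>_eq lie_bracket_nab)
  then show ?thesis using assms by (simp add: metric_compatible lie_bracket_nab diff_left)
qed

text \<open>\<xi> has constant length 1, so differentiating \<open>g (\<xi>) (\<xi>)\<close> gives
  zero.\<close>

lemma nab_\<xi>_orthogonal:
  assumes "X \<in> vector_fields A"
  shows "g p (nab X \<xi> p) (\<xi> p) = 0" "g p (\<xi> p) (nab X \<xi> p) = 0"
proof -
  have "X p (\<lambda>q. g q (\<xi> q) (\<xi> q)) = 0"
    using assms tangent_vector_const[of "X p" A p] by (simp add: g_\<xi>_\<xi>)
  then show "g p (nab X \<xi> p) (\<xi> p) = 0" "g p (\<xi> p) (nab X \<xi> p) = 0"
    using assms metric_compatible[of X \<xi> \<xi> p] commute[of "nab X \<xi> p" p "\<xi> p"] by simp_all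
qed

lemma J_\<xi> [simp]: "J \<xi> = 0"
  by (simp add: fun_eq_iff)

lemma nab_\<phi>_\<xi>: "X \<in> vector_fields A \<Longrightarrow> nab_\<phi> X \<xi> p = - \<phi> p (nab X \<xi> p)"
  by (simp add: nab_\<phi>_apply)

text \<open>Vanishing is proved in the direction of \<xi> and in all directions \<open>J X\<close>.
  These suffice, since \<open>J (J X) + X\<close> is a multiple of \<xi>.\<close>

lemma nab_\<xi>:
  assumes X: "X \<in> vector_fields A"
  shows "nab X \<xi> p = 0"
proof -
  \<comment> \<open>Symmetry rewrites the squared length of \<open>nab \<xi> \<xi>\<close> as a
    pairing of \<xi> with a derivative of \<xi>, which is zero.\<close>
  have \<xi>\<xi>: "nab \<xi> \<xi> p = 0"
    using nab_\<xi>_symmetric[of \<xi> "nab \<xi> \<xi>" p] nab_\<xi>_orthogonal[of "nab \<xi> \<xi>" p]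
      eq_zero[of "nab \<xi> \<xi> p" p]
    by simp
  have J: "nab (J X) \<xi> p = 0" if X: "X \<in> vector_fields A" for X
  proof -
    \<comment> \<open>The vector to be annihilated serves as its own test field: the pairing of
      \<open>nab_\<phi> \<xi> X\<close> with it is computed in two ways.\<close>
    define Y where "Y = nab (J X) \<xi>"
    have Y: "Y \<in> vector_fields A" using X by (simp add: Y_def)
    have "\<eta> p (nab_\<phi> \<xi> X p) = 0"
    proof -
      have "nab_\<phi> \<xi> \<xi> p = 0" using nab_\<phi>_\<xi>[of \<xi> p] \<xi>\<xi> by simp
      then show ?thesis using X nab_\<phi>_skew[of \<xi> X \<xi> p] zero_left[of "X p" p] by (simp add: \<eta>_eq)
    qed
    \<comment> \<open>Normality for the pair \<open>X\<close>, \<xi>; the term with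
      \<open>J \<xi>\<close> drops out because \<open>J \<xi> = 0\<close>.\<close>
    moreover have "\<phi> p (nab_\<phi> \<xi> X p) = \<phi> p (nab (J X) \<xi> p) + nab X \<xi> p"
    proof -
      have "nab_\<phi> 0 X p = 0" using X by (simp add: nab_\<phi>_apply)
      moreover have "\<phi> p (\<phi> p (nab X \<xi> p)) = - nab X \<xi> p"
        using X nab_\<xi>_orthogonal[of X p] \<phi>_\<phi>[of "nab X \<xi> p" p] by (simp add: \<eta>_eq)
      ultimately have "- \<phi> p (nab (J X) \<xi> p) = nab X \<xi> p - \<phi> p (nab_\<phi> \<xi> X p)"
        using X normality[of X \<xi> p] by (simp add: nab_\<phi>_\<xi> \<phi>_neg)
      then show ?thesis by (simp add: neg_eq_iff_add_eq_0 algebra_simps)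
    qed
    moreover have "\<eta> p (nab (J X) \<xi> p) = 0"
      using X nab_\<xi>_orthogonal[of "J X" p] by (simp add: \<eta>_eq)
    \<comment> \<open>Both vectors have zero \<eta>-component, so \<phi> preserves their pairings
      with \<open>Y\<close>.\<close>
    ultimately have "g p (nab_\<phi> \<xi> X p) (Y p) = g p (\<phi> p (nab (J X) \<xi> p) + nab X \<xi> p) (\<phi> p (Y p))"
      and "g p (\<phi> p (nab (J X) \<xi> p)) (\<phi> p (Y p)) = g p (nab (J X) \<xi> p) (Y p)"
      using X Y g_\<phi>_\<phi>[of "nab_\<phi> \<xi> X p" p "Y p"] g_\<phi>_\<phi>[of "nab (J X) \<xi> p" p "Y p"] by simp_all
    then have "g p (nab_\<phi> \<xi> X p) (Y p) =
        g p (nab (J X) \<xi> p) (Y p) + g p (nab X \<xi> p) (\<phi> p (Y p))"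
      using X Y add_left[of "\<phi> p (nab (J X) \<xi> p)" p "nab X \<xi> p" "\<phi> p (Y p)"] by simp
    \<comment> \<open>The second computation uses the cyclic identity for \<xi>, \<open>X\<close>,
      \<open>Y\<close>. It differs from the first only in the sign of
      \<open>g p (nab (J X) \<xi> p) (Y p)\<close>, the squared length of \<open>Y\<close>, which
      must therefore be zero.\<close>
    moreover have "g p (nab_\<phi> \<xi> X p) (Y p) =
        g p (nab X \<xi> p) (\<phi> p (Y p)) - g p (nab (J X) \<xi> p) (Y p)"
    proof -
      have "g p (nab_\<phi> X Y p) (\<xi> p) = - g p (nab_\<phi> X \<xi> p) (Y p)"
        using X Y by (intro nab_\<phi>_skew) simp_all
      also have "\<dots> = - g p (nab X \<xi> p) (\<phi> p (Y p))"
        using X Y by (simp add: nab_\<phi>_\<xi> neg_left \<phi>_skew)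
      finally have 1: "g p (nab_\<phi> X Y p) (\<xi> p) = - g p (nab X \<xi> p) (\<phi> p (Y p))" .
      have "g p (nab_\<phi> Y \<xi> p) (X p) = g p (nab Y \<xi> p) (J X p)"
        using X Y by (simp add: nab_\<phi>_\<xi> neg_left \<phi>_skew)
      also have "\<dots> = g p (J X p) (nab Y \<xi> p)"
        using X Y by (intro commute) simp_all
      also have "\<dots> = g p (Y p) (nab (J X) \<xi> p)"
        using X Y nab_\<xi>_symmetric[of Y "J X" p] by (simp only: J_vector_field)
      also have "\<dots> = g p (nab (J X) \<xi> p) (Y p)"
        using X Y by (intro commute) simp_all
      finally show ?thesis using 1 X Y nab_\<phi>_cyclic[of \<xi> X Y p] by simp
    qed
    ultimately have "g p (Y p) (Y p) = 0" by (simp add: Y_def)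
    then show ?thesis using Y eq_zero[of "Y p" p] by (simp flip: Y_def)
  qed
  have "nab (J (J X)) \<xi> + nab X \<xi> = fmult (\<lambda>p. g p (X p) (\<xi> p)) (nab \<xi> \<xi>)"
    using X nab_add_left[of "J (J X)" X \<xi>] by (simp add: J_J nab_fmult_left metric_smooth)
  from fun_cong[OF this, of p] show ?thesis
    using X J[of "J X"] \<xi>\<xi> by (simp add: fmult_def)
qed

text \<open>With \<xi> parallel, \<open>nab_\<phi>\<close> anticommutes with \<phi>. Cyclicity,
  skewness and normality then leave no room for a nonzero tensor, as in the Kaehler case.\<close>

lemma structure_equation:
  assumes "X \<in> vector_fields A" "Y \<in> vector_fields A"
  shows "nab X (J Y) p = \<phi> p (nab X Y p)"
proof -
  define s where "s X Y Z = g p (nab_\<phi> X Y p) (Z p)" for X Y Z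
  have skew: "s X Y Z = - s X Z Y"
    if "X \<in> vector_fields A" "Y \<in> vector_fields A" "Z \<in> vector_fields A" for X Y Z
    using nab_\<phi>_skew[OF that] by (simp add: s_def)
  have cyclic: "s X Y Z + s Y Z X + s Z X Y = 0"
    if "X \<in> vector_fields A" "Y \<in> vector_fields A" "Z \<in> vector_fields A" for X Y Z
    using nab_\<phi>_cyclic[OF that] by (simp add: s_def)
  have J: "nab_\<phi> X (J Y) p = - \<phi> p (nab_\<phi> X Y p)"
    if "X \<in> vector_fields A" "Y \<in> vector_fields A" for X Y
    using nab_\<phi>_J[OF that, of p] that by (simp add: nab_\<xi> zero_right eq_neg_iff_add_eq_0)
  have swap: "s X (J Y) Z = s X Y (J Z)"
    if "X \<in> vector_fields A" "Y \<in> vector_fields A" "Z \<in> vector_fields A" for X Y Z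
    using that \<phi>_skew[of "nab_\<phi> X Y p" p "Z p"] by (simp add: s_def J neg_left)
  have normal: "s (J X) Y Z - s (J Y) X Z = s Y X (J Z) - s X Y (J Z)"
    if "X \<in> vector_fields A" "Y \<in> vector_fields A" "Z \<in> vector_fields A" for X Y Z
  proof -
    have "g p (nab_\<phi> (J X) Y p - nab_\<phi> (J Y) X p) (Z p) =
        g p (\<phi> p (nab_\<phi> X Y p) - \<phi> p (nab_\<phi> Y X p)) (Z p)"
      using normality[of X Y p] that by simp
    then show ?thesis
      using that \<phi>_skew[of "nab_\<phi> X Y p" p "Z p"] \<phi>_skew[of "nab_\<phi> Y X p" p "Z p"]
      by (simp add: s_def diff_left)
  qed
  \<comment> \<open>Subtract the two cyclic identities below. Normality cancels the terms
    differentiated along \<open>X\<close>, \<open>Y\<close>, \<open>J X\<close> and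
    \<open>J Y\<close>, and what remains is twice the claimed quantity.\<close>
  have zero: "s Z X (J Y) = 0"
    if "X \<in> vector_fields A" "Y \<in> vector_fields A" "Z \<in> vector_fields A" for X Y Z
  proof -
    note [simp] = that
    have "s (J X) Y Z + s Y Z (J X) + s Z (J X) Y = 0" "s (J Y) X Z + s X Z (J Y) + s Z (J Y) X = 0"
      by (simp_all add: cyclic)
    moreover have "s Z (J X) Y = s Z X (J Y)" "s Z (J Y) X = - s Z X (J Y)"
      using skew[of Z "J Y" X] swap by simp_all
    moreover have "s X Y (J Z) = - s X Z (J Y)" "s Y X (J Z) = - s Y Z (J X)"
      using skew[of X Y "J Z"] skew[of Y X "J Z"] swap by simp_all
    ultimately show ?thesis using normal[of X Y Z] by simp
  qed
  \<comment> \<open>Testing with \<open>J (J Z)\<close> gives minus the squared length of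
    \<open>Z\<close>, because the \<xi>-component contributes \<open>s X Y \<xi> = 0\<close>; by
    \<open>zero\<close> the same value is 0.\<close>
  define Z where "Z = nab_\<phi> X Y"
  have Z: "Z \<in> vector_fields A" using assms by (simp add: Z_def)
  have "s X Y \<xi> = 0"
    using skew[of X Y \<xi>] assms by (simp add: s_def nab_\<phi>_\<xi> nab_\<xi> zero_left)
  then have "s X Y (J (J Z)) = - s X Y Z"
    using assms Z by (simp add: s_def \<phi>_\<phi> diff_right scale_right closed)
  moreover have "s X Y (J (J Z)) = 0" using zero[of Y "J Z" X] assms Z by simp
  ultimately have "g p (Z p) (Z p) = 0" by (simp add: s_def Z_def)
  then have "nab_\<phi> X Y p = 0" using Z eq_zero[of "Z p" p] by (simp flip: Z_def)
  then show ?thesis by (simp add: nab_\<phi>_apply)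
qed

end


section \<open>Anti-invariant submersions\<close>

lemma subspace_vertical:
  assumes "smooth_manifold A"
  shows "subspace (vertical A B F p)"
  using subspace_tangent_space[OF assms]
  by (auto simp: vertical_def subspace_def differential_def fun_eq_iff scaleR_fun_def)

locale lagrangian_submersion = cosymplectic_manifold A g nab \<phi> \<xi> \<eta>
  for A :: "('m::{t2_space, second_countable_topology}, 'e::euclidean_space) atlas"
    and g nab \<phi> \<xi> \<eta> +
  fixes B :: "('n::{t2_space, second_countable_topology}, 'd::euclidean_space) atlas"
    and F :: "'m \<Rightarrow> 'n"
  assumes anti_invariant: "anti_invariant A \<phi> g B F"
    and horizontal_sum:
      "is_direct_sum (horizontal A g B F p) (\<phi> p ` vertical A B F p) (span {\<xi> p})"
begin

section \<open>Exchange of vertical and horizontal vectors by \<phi>\<close>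

abbreviation \<V> where "\<V> \<equiv> vertical A B F"
abbreviation \<H> where "\<H> \<equiv> horizontal A g B F"

lemma \<V>_tangent: "\<V> p \<subseteq> tangent_space A p"
  by (auto simp: vertical_def)

lemma subspace_\<V>: "subspace (\<V> p)"
  using subspace_vertical[OF manifold] .

lemma \<H>_tangent: "\<H> p \<subseteq> tangent_space A p"
  by (auto simp: horizontal_def)

lemma subspace_\<H>: "subspace (\<H> p)"
  using subspace_complement[OF \<V>_tangent] by (simp add: horizontal_def)

lemma orthogonal: "v \<in> \<H> p \<Longrightarrow> w \<in> \<V> p \<Longrightarrow> g p v w = 0"
  by (simp add: horizontal_def)

lemma \<xi>_horizontal: "\<xi> p \<in> \<H> p"
proof -
  have "0 \<in> \<phi> p ` \<V> p" using subspace_0[OF subspace_\<V>] \<phi>_zero by (metis imageI)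
  moreover have "\<xi> p \<in> span {\<xi> p}" by (simp add: span_base)
  moreover have "\<H> p = {v + w |v w. v \<in> \<phi> p ` \<V> p \<and> w \<in> span {\<xi> p}}"
    using horizontal_sum by (simp add: is_direct_sum_def)
  ultimately have "0 + \<xi> p \<in> \<H> p" by blast
  then show ?thesis by simp
qed

lemma \<eta>_vertical:
  assumes "v \<in> \<V> p"
  shows "\<eta> p v = 0"
  using orthogonal[OF \<xi>_horizontal assms] assms \<V>_tangent[of p] commute[of v p "\<xi> p"] \<eta>_eq[of v p]
  by auto

lemma \<phi>_vertical: "v \<in> \<V> p \<Longrightarrow> \<phi> p v \<in> \<H> p"
  using anti_invariant by (auto simp: anti_invariant_def)

text \<open>Split \<open>v\<close> as \<open>\<phi> p w\<close> plus a multiple of \<xi>. Then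
  \<phi> kills the second part and sends the first to \<open>- w\<close>, since \<eta> vanishes on
  vertical vectors.\<close>

lemma \<phi>_horizontal:
  assumes "v \<in> \<H> p"
  shows "\<phi> p v \<in> \<V> p"
proof -
  have "\<H> p = {v + w |v w. v \<in> \<phi> p ` \<V> p \<and> w \<in> span {\<xi> p}}"
    using horizontal_sum by (simp add: is_direct_sum_def)
  then obtain w c where w: "w \<in> \<V> p" "v = \<phi> p w + c *\<^sub>R \<xi> p"
    using assms by (auto simp: span_singleton)
  have wT: "w \<in> tangent_space A p" using w(1) \<V>_tangent by blast
  have "\<phi> p v = - w"
    using wT \<eta>_vertical[OF w(1)] by (simp add: w(2) \<phi>_add \<phi>_scale \<phi>_\<phi> closed)
  then show ?thesis using subspace_neg[OF subspace_\<V> w(1)] by simp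
qed

text \<open>For the converse, \<phi> is applied once more: \<open>v\<close> is \<xi> times its
  \<eta>-component minus the horizontal vector \<open>\<phi> p (\<phi> p v)\<close>.\<close>

lemma \<phi>_vertical_iff:
  assumes "v \<in> tangent_space A p"
  shows "\<phi> p v \<in> \<V> p \<longleftrightarrow> v \<in> \<H> p"
proof
  assume "\<phi> p v \<in> \<V> p"
  then have "\<phi> p (\<phi> p v) \<in> \<H> p" by (rule \<phi>_vertical)
  then have "\<eta> p v *\<^sub>R \<xi> p - \<phi> p (\<phi> p v) \<in> \<H> p"
    using subspace_diff subspace_scale subspace_\<H> \<xi>_horizontal by blast
  then show "v \<in> \<H> p" using assms by (simp add: \<phi>_\<phi>)
qed (rule \<phi>_horizontal)

text \<open>The condition on \<eta> excludes \<xi>, whose image 0 is horizontal although \<xi> is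
  not vertical.\<close>

lemma \<phi>_horizontal_iff:
  assumes "v \<in> tangent_space A p" "\<eta> p v = 0"
  shows "\<phi> p v \<in> \<H> p \<longleftrightarrow> v \<in> \<V> p"
proof
  assume "\<phi> p v \<in> \<H> p"
  then have "\<phi> p (\<phi> p v) \<in> \<V> p" by (rule \<phi>_horizontal)
  then have "- (\<phi> p (\<phi> p v)) \<in> \<V> p" using subspace_neg subspace_\<V> by blast
  then show "v \<in> \<V> p" using assms by (simp add: \<phi>_\<phi>)
qed (rule \<phi>_vertical)

section \<open>Kernels of the two projections\<close>

lemma vproj_eq_0_iff:
  assumes "X p \<in> tangent_space A p"
  shows "vproj A g B F X p = 0 \<longleftrightarrow> X p \<in> \<H> p"
proof -
  obtain C where "finite C" "tangent_space A p = span C"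
    using tangent_space_finite_span[OF manifold] .
  then show ?thesis
    using orth_proj_eq_0_iff[OF _ _ subspace_\<V> \<V>_tangent assms] assms
    by (simp add: vproj_def horizontal_def)
qed

lemma hproj_eq_0_iff:
  assumes "X p \<in> tangent_space A p"
  shows "hproj A g B F X p = 0 \<longleftrightarrow> X p \<in> \<V> p"
proof -
  obtain C where "finite C" "tangent_space A p = span C"
    using tangent_space_finite_span[OF manifold] .
  then show ?thesis
    using orth_proj_complement_eq_0_iff[OF _ _ subspace_\<V> \<V>_tangent assms]
    by (simp add: hproj_def horizontal_def)
qed

lemma vproj_vertical: "(\<And>p. X p \<in> \<V> p) \<Longrightarrow> vproj A g B F X = X"
  by (simp add: vproj_def fun_eq_iff orth_proj_self[OF subspace_\<V> \<V>_tangent])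

lemma hproj_horizontal: "(\<And>p. X p \<in> \<H> p) \<Longrightarrow> hproj A g B F X = X"
  by (simp add: hproj_def fun_eq_iff orth_proj_self[OF subspace_\<H> \<H>_tangent])

lemma vproj_horizontal:
  assumes "\<And>p. X p \<in> \<H> p"
  shows "vproj A g B F X = 0"
proof
  fix p
  show "vproj A g B F X p = 0 p"
    using vproj_eq_0_iff[of X p] assms[of p] \<H>_tangent by auto
qed

lemma hproj_vertical:
  assumes "\<And>p. X p \<in> \<V> p"
  shows "hproj A g B F X = 0"
proof
  fix p
  show "hproj A g B F X p = 0 p"
    using hproj_eq_0_iff[of X p] assms[of p] \<V>_tangent by auto
qed

text \<open>\<open>J Y\<close> is vertical, so only the horizontal part of
  \<open>nab X (J Y)\<close> survives in the tensor; the structure equation turns that field into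
  \<phi> applied to \<open>nab X Y\<close>.\<close>

lemma oneill_A_J_eq_0_iff:
  assumes "X \<in> sections A \<H>" "Y \<in> sections A \<H>"
  shows "oneill_A A g nab B F X (J Y) = 0 \<longleftrightarrow> (\<forall>p. nab X Y p \<in> \<H> p)"
proof -
  have XY: "X \<in> vector_fields A" "Y \<in> vector_fields A" "\<And>p. X p \<in> \<H> p" "\<And>p. J Y p \<in> \<V> p"
    using assms \<phi>_horizontal by (auto simp: sections_def)
  have "vproj A g B F 0 = 0"
    by (rule vproj_horizontal) (simp add: subspace_0[OF subspace_\<H>])
  then have "oneill_A A g nab B F X (J Y) = hproj A g B F (nab X (J Y))"
    using XY by (simp add: oneill_A_def hproj_horizontal hproj_vertical vproj_vertical del: J_apply)
  then have "oneill_A A g nab B F X (J Y) = 0 \<longleftrightarrow> (\<forall>p. nab X (J Y) p \<in> \<V> p)"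
    using XY hproj_eq_0_iff[of "nab X (J Y)"] by (simp add: fun_eq_iff[of _ 0])
  then show ?thesis
    using XY \<phi>_vertical_iff[of "nab X Y p" for p] by (simp add: structure_equation)
qed

text \<open>The pairing of \<open>W\<close> with \<xi> vanishes identically; differentiate it along
  \<open>V\<close> and use that \<xi> is parallel.\<close>

lemma \<eta>_nab_vertical:
  assumes "V \<in> sections A \<V>" "W \<in> sections A \<V>"
  shows "\<eta> p (nab V W p) = 0"
proof -
  have VW: "V \<in> vector_fields A" "W \<in> vector_fields A" "\<And>p. W p \<in> \<V> p"
    using assms by (auto simp: sections_def)
  have "V p (\<lambda>q. g q (W q) (\<xi> q)) = V p (\<lambda>q. 0)"
    using VW \<eta>_vertical \<eta>_eq by (metis vector_fields_tangent)
  then have "g p (nab V W p) (\<xi> p) = 0"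
    using VW tangent_vector_const[of "V p" A p 0] by (simp add: metric_compatible nab_\<xi> zero_right)
  then show ?thesis using VW by (simp add: \<eta>_eq)
qed

text \<open>Here \<open>J W\<close> is horizontal and the vertical part of
  \<open>nab V (J W)\<close> survives. \<open>\<eta>_nab_vertical\<close> supplies the condition
  needed to pass back through \<phi>.\<close>

lemma oneill_T_J_eq_0_iff:
  assumes "V \<in> sections A \<V>" "W \<in> sections A \<V>"
  shows "oneill_T A g nab B F V (J W) = 0 \<longleftrightarrow> (\<forall>p. nab V W p \<in> \<V> p)"
proof -
  have VW: "V \<in> vector_fields A" "W \<in> vector_fields A" "\<And>p. V p \<in> \<V> p" "\<And>p. J W p \<in> \<H> p"
    using assms \<phi>_vertical by (auto simp: sections_def)
  have "hproj A g B F 0 = 0"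
    by (rule hproj_vertical) (simp add: subspace_0[OF subspace_\<V>])
  then have "oneill_T A g nab B F V (J W) = vproj A g B F (nab V (J W))"
    using VW by (simp add: oneill_T_def hproj_horizontal vproj_horizontal vproj_vertical del: J_apply)
  then have "oneill_T A g nab B F V (J W) = 0 \<longleftrightarrow> (\<forall>p. nab V (J W) p \<in> \<H> p)"
    using VW vproj_eq_0_iff[of "nab V (J W)"] by (simp add: fun_eq_iff[of _ 0])
  then show ?thesis
    using VW \<phi>_horizontal_iff[OF _ \<eta>_nab_vertical[OF assms]] by (simp add: structure_equation)
qed

text \<open>The conjuncts match crosswise: the tensor \<open>T\<close> governs the vertical
  foliation and \<open>A\<close> the horizontal one.\<close>

lemma locally_product_iff:
  "locally_product_manifold A g nab B F \<longleftrightarrow>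
    (\<forall>X \<in> sections A \<H>. \<forall>Y \<in> sections A \<H>. oneill_A A g nab B F X (J Y) = 0) \<and>
    (\<forall>V \<in> sections A \<V>. \<forall>W \<in> sections A \<V>. oneill_T A g nab B F V (J W) = 0)"
  by (auto simp: locally_product_manifold_def totally_geodesic_foliation_iff subspace_\<V>
      subspace_\<H> oneill_A_J_eq_0_iff oneill_T_J_eq_0_iff)

end

theorem theorem18:
  fixes AM :: "('m::{t2_space, second_countable_topology}, 'e::euclidean_space) atlas"
    and AN :: "('n::{t2_space, second_countable_topology}, 'd::euclidean_space) atlas"
    and \<phi> :: "'m endomorphism_field" and \<xi> :: "'m vector_field" and \<eta> :: "'m one_form"
    and gM :: "'m bilinear_form" and gN :: "'n bilinear_form"
    and nab :: "'m vector_field \<Rightarrow> 'm vector_field \<Rightarrow> 'm vector_field"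
    and F :: "'m \<Rightarrow> 'n"
  assumes "smooth_manifold AM"
    and "cosymplectic AM \<phi> \<xi> \<eta> gM"
    and "levi_civita AM gM nab"
    and "smooth_manifold AN"
    and "riemannian_metric AN gN"
    and "riemannian_submersion AM gM AN gN F"
    and "anti_invariant AM \<phi> gM AN F"
    and "\<And>p. is_direct_sum (horizontal AM gM AN F p) (\<phi> p ` vertical AM AN F p) (span {\<xi> p})"
  shows "locally_product_manifold AM gM nab AN F \<longleftrightarrow>
    (\<forall>X \<in> sections AM (horizontal AM gM AN F). \<forall>Y \<in> sections AM (horizontal AM gM AN F).
      oneill_A AM gM nab AN F X (tapply \<phi> Y) = 0) \<and>
    (\<forall>V \<in> sections AM (vertical AM AN F). \<forall>W \<in> sections AM (vertical AM AN F).
      oneill_T AM gM nab AN F V (tapply \<phi> W) = 0)"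
proof -
  have "riemannian_metric AM gM"
    using assms(2) unfolding cosymplectic_def almost_contact_metric_def by blast
  then interpret lagrangian_submersion AM gM nab \<phi> \<xi> \<eta> AN F
    using assms by unfold_locales
  show ?thesis by (rule locally_product_iff)
qed

end
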